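(* Let $1\le p<\infty$, let $N\ge1$ and let $n_1<\dots<n_N$ be nonnegative integers, with associated Hermite functions $h_{n_1},\dots,h_{n_N}$. Let $f\in L^2(\mathbb{R})$ be the true signal, normalized so that $f(0)=|f(0)|>0$, and such that, with $$u(x):=\int_{\mathbb{R}}\mathcal{A}f(x,y)e^{\pi i x y}\,dy,$$ the reconstruction formula $u(x)=f(x)\overline{f(0)}$ holds for almost every $x\in\mathbb{R}$ and for $x=0$ (so $u(0)=|f(0)|^2>0$). Let $\eta_1,\dots,\eta_N\in L^1(\mathbb{R}^2)$, $F_j=|V_{h_{n_j}}f|^2$ and $F_j^\eta=|V_{h_{n_j}}f|^2+\eta_j$. For some $\varepsilon>0$, let $\Omega_1,\dots,\Omega_N\subset\mathbb{R}^2$ be pairwise disjoint measurable sets such that $|\mathcal{A}h_{n_j}|>\varepsilon$ on $\Omega_j$ for all $j$, and let $\Omega=\bigcup_{j=1}^N\Omega_j$. Let $$A(x,y)=\frac{\mathcal{F}(F_j)(y,-x)}{\overline{\mathcal{A}h_{n_j}(x,y)}},\qquad A^\eta(x,y)=\frac{\mathcal{F}(F_j^\eta)(y,-x)}{\overline{\mathcal{A}h_{n_j}(x,y)}}\qquad\text{for }(x,y)\in\Omega_j,\ j=1,\dots,N,$$ and $A=A^\eta=0$ on $\mathbb{R}^2\setminus\Omega$. Let $\widetilde u(x)=\int_{\mathbb{R}}A(x,y)e^{\pi i x y}\,dy$ and $\widetilde u^\eta(x)=\int_{\mathbb{R}}A^\eta(x,y)e^{\pi i x y}\,dy$, assume $\widetilde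 u(0)\ne0$ and $\widetilde u^\eta(0)\ne0$, and set $k:=\sqrt{|\widetilde u(0)|}$, $k^\eta:=\sqrt{|\widetilde u^\eta(0)|}$, $k^{\mathrm{true}}:=\sqrt{u(0)}$ and $\widetilde f^{\,\eta}:=\widetilde u^\eta/k^\eta$. Let $C_p:=\|\mathbf{1}_\Omega\|_{L^{p,1}(\mathbb{R}^2)}$ and $C_{\mathbb{R},\Omega}:=|\{y\in\mathbb{R}:(0,y)\in\Omega\}|$ (one-dimensional Lebesgue measure). Then $$\begin{aligned}\|f-\widetilde f^{\,\eta}\|_{L^p(\mathbb{R})}\le{}&\frac1{k^{\mathrm{true}}}\|\mathcal{A}f\|_{L^{p,1}(\mathbb{R}^2\setminus\Omega)}+\frac{1}{2(k^{\mathrm{true}}\,k)^{3/2}}\|\mathcal{A}f(0,\cdot)\|_{L^1((\mathbb{R}^2\setminus\Omega)\cap(\{0\}\times\mathbb{R}))}\,\|A\|_{L^{p,1}(\mathbb{R}^2)}\\&+\left(\frac{1}{2(k\,k^\eta)^{3/2}}\|A\|_{L^{p,1}(\mathbb{R}^2)}+\frac1{k^\eta}\right)\frac1\varepsilon\max(C_{\mathbb{R},\Omega},C_p)\max_{j=1,\dots,N}\|\eta_j\|_{L^1(\mathbb{R}^2)},\end{aligned}$$ and consequently, for some constant $C>0$ depending only on $\|A\|_{L^{p,1}(\mathbb{R}^2)},k,k^\eta,k^{\mathrm{true}},C_{\mathbb{R},\Omega}$ and $C_p$, $$\|f-\widetilde f^{\,\eta}\|_{L^p(\mathbb{R})}\le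 C\left(\|\mathcal{A}f\|_{L^{p,1}(\mathbb{R}^2\setminus\Omega)}+\|\mathcal{A}f(0,\cdot)\|_{L^1((\mathbb{R}^2\setminus\Omega)\cap(\{0\}\times\mathbb{R}))}+\frac1\varepsilon\max_{j=1,\dots,N}\|\eta_j\|_{L^1(\mathbb{R}^2)}\right).$$
   Context: The short-time Fourier transform of $f\in L^2(\mathbb{R})$ with window $g\in L^2(\mathbb{R})$ is $V_gf(x,y)=\int_{\mathbb{R}}f(t)\overline{g(t-x)}e^{-2\pi i t y}\,dt$. The ambiguity function of $f$ is $\mathcal{A}f(x,y)=\int_{\mathbb{R}}f(t+x/2)\overline{f(t-x/2)}e^{-2\pi i t y}\,dt=e^{\pi i x y}V_ff(x,y)$. $\mathcal{F}$ is the two-dimensional Fourier transform $\mathcal{F}(G)(\xi)=\int_{\mathbb{R}^2}G(z)e^{-2\pi i z\cdot\xi}\,dz$. Known relation (from the orthogonality relations of the STFT): $\mathcal{F}(|V_gf|^2)(y,-x)=\mathcal{A}f(x,y)\,\overline{\mathcal{A}g(x,y)}$ for $f,g\in L^2(\mathbb{R})$. The $n$-th Hermite function is $h_n(t)=c_ne^{\pi t^2}\frac{d^n}{dt^n}e^{-2\pi t^2}$, with $c_n$ a constant such that $\|h_n\|_{L^2(\mathbb{R})}=1$. Its ambiguity function is $\mathcal{A}h_n(x,y)=e^{-\pi(x^2+y^2)/2}L_n(\pi(x^2+y^2))$, where $L_n(z)=\sum_{k=0}^n\binom{n}{k}\frac{(-z)^k}{k!}$ is the Laguerre polynomial. Mixed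 norm: $\|U\|_{L^{p,1}(\mathbb{R}^2)}=\int_{\mathbb{R}}\big(\int_{\mathbb{R}}|U(x,y)|^p\,dx\big)^{1/p}dy$, and $\|U\|_{L^{p,1}(\mathbb{R}^2\setminus\Omega)}:=\|\mathbf{1}_{\mathbb{R}^2\setminus\Omega}U\|_{L^{p,1}(\mathbb{R}^2)}$, with $\mathbf{1}_E$ the characteristic function of $E$. Moreover $\|\mathcal{A}f(0,\cdot)\|_{L^1((\mathbb{R}^2\setminus\Omega)\cap(\{0\}\times\mathbb{R}))}=\int_{\{y:(0,y)\notin\Omega\}}|\mathcal{A}f(0,y)|\,dy$. The norms on the right-hand side may be $+\infty$, in which case the bound is trivial. *)

theory Defs
  imports "HOL-Analysis.Analysis"
begin

definition square_integrable :: "(real \<Rightarrow> complex) \<Rightarrow> bool" where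
  "square_integrable f \<longleftrightarrow>
     f \<in> borel_measurable lebesgue \<and> integrable lebesgue (\<lambda>t. (cmod (f t))\<^sup>2)"

definition STFT :: "(real \<Rightarrow> complex) \<Rightarrow> (real \<Rightarrow> complex) \<Rightarrow> real \<times> real \<Rightarrow> complex" where
  "STFT g f = (\<lambda>(x, y). LINT t|lebesgue. f t * cnj (g (t - x)) * cis (- 2 * pi * t * y))"

definition ambiguity :: "(real \<Rightarrow> complex) \<Rightarrow> real \<times> real \<Rightarrow> complex" where
  "ambiguity f = (\<lambda>(x, y).
     LINT t|lebesgue. f (t + x / 2) * cnj (f (t - x / 2)) * cis (- 2 * pi * t * y))"

definition fourier2 :: "(real \<times> real \<Rightarrow> complex) \<Rightarrow> real \<times> real \<Rightarrow> complex" where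
  "fourier2 G \<xi> = (LINT z|lebesgue. G z * cis (- 2 * pi * (z \<bullet> \<xi>)))"

text \<open>The normalizing constant is determined only up to a unimodular factor, so being an
  \<open>n\<close>-th Hermite function is a predicate rather than a choice of one such function.\<close>

definition is_hermite_function :: "nat \<Rightarrow> (real \<Rightarrow> complex) \<Rightarrow> bool" where
  "is_hermite_function n h \<longleftrightarrow>
     (\<exists>c :: complex. \<forall>t. h t = c * complex_of_real
         (exp (pi * t\<^sup>2) * (deriv ^^ n) (\<lambda>s :: real. exp (- 2 * pi * s\<^sup>2)) t)) \<and>
     has_bochner_integral lebesgue (\<lambda>t. (cmod (h t))\<^sup>2) 1"

definition phase_integral :: "(real \<times> real \<Rightarrow> complex) \<Rightarrow> real \<Rightarrow> complex" where
  "phase_integral U x = (LINT y|lebesgue. U (x, y) * cis (pi * x * y))"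

definition ennreal_powr :: "ennreal \<Rightarrow> real \<Rightarrow> ennreal" where
  "ennreal_powr a r = (if a = \<infinity> then \<infinity> else ennreal (enn2real a powr r))"

text \<open>All norms take values in \<open>[0, \<infinity>]\<close>.\<close>

definition Lp_norm :: "real \<Rightarrow> ('a::euclidean_space \<Rightarrow> complex) \<Rightarrow> ennreal" where
  "Lp_norm p g = ennreal_powr (\<integral>\<^sup>+ x. ennreal (cmod (g x) powr p) \<partial>lebesgue) (1 / p)"

definition mixed_norm :: "real \<Rightarrow> (real \<times> real \<Rightarrow> complex) \<Rightarrow> ennreal" where
  "mixed_norm p U = (\<integral>\<^sup>+ y. Lp_norm p (\<lambda>x. U (x, y)) \<partial>lebesgue)"

text \<open>The slice of a Lebesgue measurable subset of the plane along the single line \<open>x = 0\<close> need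
  not be measurable. The integral form agrees with the measure whenever the slice is measurable
  (see the lemma below), and unlike \<^const>\<open>emeasure\<close> it does not become \<open>0\<close> by
  convention otherwise.\<close>

definition axis_measure :: "(real \<times> real) set \<Rightarrow> ennreal" where
  "axis_measure E = (\<integral>\<^sup>+ y \<in> {y. (0, y) \<in> E}. 1 \<partial>lebesgue)"

lemma axis_measure_eq_emeasure:
  "{y. (0, y) \<in> E} \<in> sets lebesgue \<Longrightarrow> axis_measure E = emeasure lebesgue {y. (0, y) \<in> E}"
  by (simp add: axis_measure_def)

end

theory Submission
  imports Defs "HOL-Probability.Characteristic_Functions"
begin

text \<open>Dividing the reconstruction formula \<open>u = f \<cdot> cnj (f 0)\<close> by \<open>kt = f 0\<close>, the error is
\<open>f - u\<eta> / k\<eta> = (u - u') / kt + (1 / kt - 1 / k) u' + (1 / k - 1 / k\<eta>) u' + (u' - u\<eta>) / k\<eta>\<close>,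
and the terms of the bound correspond to these four pieces.

Minkowski's integral inequality (\<open>minkowski_integral\<close>) bounds the \<open>L\<^sup>p\<close> norm of a phase integral,
or of a difference of two, by a mixed norm in the plane (\<open>Lp_norm_phase_integral_diff\<close>).  For the
two middle pieces, \<open>\<bar>1 / a - 1 / b\<bar> \<le> \<bar>a\<^sup>2 - b\<^sup>2\<bar> / (2 (a b)\<^bsup>3/2\<^esup>)\<close> by the inequality of means, and the squares
of the normalising constants are moduli of phase integrals at \<open>0\<close>, so that they differ by at most
an integral over the line \<open>x = 0\<close>.  What remains is to know the integrands: \<open>A\<close> is the ambiguity
function of \<open>f\<close> cut off to \<open>\<Omega>\<close>, and on each piece of \<open>\<Omega>\<close> the noise changes it by
the Fourier transform of \<open>\<eta>\<close> divided by the ambiguity function of the window, which has modulus at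
most \<open>\<parallel>\<eta>\<parallel> / \<epsilon>\<close>.

This uses the orthogonality relation \<open>fourier2_spectrogram\<close>.  For almost every \<open>s\<close> the
function \<open>\<phi> t = f t * cnj (g (t - s))\<close> is both integrable and square integrable, and Plancherel's formula says
that \<open>\<bar>fourier1 \<phi>\<bar>\<^sup>2\<close> is integrable with inverse Fourier transform the autocorrelation of \<open>\<phi>\<close>.  Integrating over
\<open>s\<close> separates \<open>f\<close> from \<open>g\<close>.  Plancherel's formula itself is obtained by
regularising with Gaussians, whose Fourier transforms are known from the characteristic function
of the normal distribution, and from the continuity of the autocorrelation, that is,
from the continuity of translations in the mean.

The second inequality needs a real constant, hence finite values of \<open>\<parallel>A\<parallel>\<close>, of \<open>CR\<close> and of \<open>Cp\<close>.  They are
finite because \<open>\<Omega>\<close> is bounded: the orthogonality relation with both functions equal to the window \<open>g\<close> shows that the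
squared modulus of its ambiguity function is, up to a rotation of the variables, the Fourier transform of an
integrable function, and so tends to \<open>0\<close> at infinity by the Riemann-Lebesgue lemma
(\<open>ambiguity_superlevel_bounded\<close>).\<close>

section \<open>Continuity of translations in the mean\<close>

lemma integrable_lborel_translate:
  fixes f :: "'a::euclidean_space \<Rightarrow> 'b::{banach, second_countable_topology}"
  assumes "integrable lborel f"
  shows "integrable lborel (\<lambda>x. f (x + r))"
proof -
  have [measurable]: "f \<in> borel_measurable borel"
    using assms by (simp add: borel_measurable_integrable)
  have "integrable (distr lborel borel ((+) r)) f"
    using assms by (simp add: lborel_distr_plus)
  then show ?thesis
    by (simp add: integrable_distr_eq add.commute)
qed

lemma integral_lborel_translate:
  fixes f :: "'a::euclidean_space \<Rightarrow> 'b::{banach, second_countable_topology}"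
  assumes [measurable]: "f \<in> borel_measurable borel"
  shows "(LINT x|lborel. f (x + r)) = (LINT x|lborel. f x)"
proof -
  have "(LINT x|distr lborel borel ((+) r). f x) = (LINT x|lborel. f (r + x))"
    by (rule integral_distr) auto
  then show ?thesis
    by (simp add: lborel_distr_plus add.commute)
qed

lemma integral_dominated_convergence_at:
  fixes s :: "'c::first_countable_topology \<Rightarrow> 'a \<Rightarrow> 'b::{banach, second_countable_topology}"
  assumes "f \<in> borel_measurable M" "\<And>r. s r \<in> borel_measurable M" "integrable M w"
    and "AE x in M. ((\<lambda>r. s r x) \<longlongrightarrow> f x) (at a)"
    and "\<And>r. AE x in M. norm (s r x) \<le> w x"
  shows "((\<lambda>r. LINT x|M. s r x) \<longlongrightarrow> (LINT x|M. f x)) (at a)"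
  unfolding tendsto_at_iff_sequentially comp_def
proof (intro allI impI)
  fix X assume X: "\<forall>i. X i \<in> UNIV - {a}" "X \<longlonglongrightarrow> a"
  show "(\<lambda>i. LINT x|M. s (X i) x) \<longlonglongrightarrow> (LINT x|M. f x)"
  proof (rule integral_dominated_convergence)
    show "AE x in M. (\<lambda>i. s (X i) x) \<longlonglongrightarrow> f x"
      using assms(4)
    proof eventually_elim
      case (elim x)
      then show ?case using X unfolding tendsto_at_iff_sequentially comp_def by blast
    qed
    show "AE x in M. norm (s (X i) x) \<le> w x" for i by (rule assms(5))
  qed (fact assms)+
qed

definition translation_modulus ::
    "('a::euclidean_space \<Rightarrow> 'b::{banach, second_countable_topology}) \<Rightarrow> 'a \<Rightarrow> real" where
  "translation_modulus f r = (LINT x|lborel. norm (f (x + r) - f x))"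

lemma translation_modulus_nonneg: "0 \<le> translation_modulus f r"
  unfolding translation_modulus_def by (rule integral_nonneg_AE) auto

text \<open>Translations are isometries of \<open>L\<^sup>1\<close>, so replacing \<open>f\<close> by \<open>g\<close> costs the distance of \<open>f\<close> from \<open>g\<close> twice.
This makes the functions with continuous translations a closed subset of \<open>L\<^sup>1\<close>.\<close>

lemma translation_modulus_perturb:
  assumes "integrable lborel f" "integrable lborel g"
  shows "translation_modulus f r \<le> translation_modulus g r + 2 * (LINT x|lborel. norm (f x - g x))"
proof -
  note [simp] = assms integrable_lborel_translate[OF assms(1)] integrable_lborel_translate[OF assms(2)]
  have [simp]: "integrable lborel (\<lambda>x. norm (f x - g x))"
    by (intro integrable_norm Bochner_Integration.integrable_diff) auto
  have [simp]: "integrable lborel (\<lambda>x. norm (f (x + r) - g (x + r)))"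
    by (intro integrable_norm Bochner_Integration.integrable_diff) auto
  have "translation_modulus f r \<le> (LINT x|lborel. norm (g (x + r) - g x)
          + norm (f (x + r) - g (x + r)) + norm (f x - g x))"
    unfolding translation_modulus_def
  proof (rule integral_mono)
    show "norm (f (x + r) - f x)
        \<le> norm (g (x + r) - g x) + norm (f (x + r) - g (x + r)) + norm (f x - g x)" for x
    proof -
      have "f (x + r) - f x = (g (x + r) - g x) + (f (x + r) - g (x + r)) - (f x - g x)"
        by simp
      then show ?thesis
        using norm_triangle_ineq4[of "(g (x + r) - g x) + (f (x + r) - g (x + r))" "f x - g x"]
          norm_triangle_ineq[of "g (x + r) - g x" "f (x + r) - g (x + r)"] by simp
    qed
  qed (auto intro!: integrable_norm Bochner_Integration.integrable_diff
      Bochner_Integration.integrable_add)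
  also have "\<dots> = translation_modulus g r + (LINT x|lborel. norm (f (x + r) - g (x + r)))
      + (LINT x|lborel. norm (f x - g x))"
    unfolding translation_modulus_def
    by (subst Bochner_Integration.integral_add Bochner_Integration.integral_add |
        auto intro!: integrable_norm Bochner_Integration.integrable_diff
          Bochner_Integration.integrable_add)+
  also have "(LINT x|lborel. norm (f (x + r) - g (x + r))) = (LINT x|lborel. norm (f x - g x))"
    using assms by (intro integral_lborel_translate[where f = "\<lambda>x. norm (f x - g x)"])
      (use borel_measurable_integrable[OF assms(1)] borel_measurable_integrable[OF assms(2)] in measurable)
  finally show ?thesis by simp
qed

lemma translation_modulus_approx:
  fixes f :: "'a::euclidean_space \<Rightarrow> 'b::{banach, second_countable_topology}"
  assumes f: "integrable lborel f"
    and ex: "\<And>e. e > 0 \<Longrightarrow> \<exists>g :: 'a \<Rightarrow> 'b. integrable lborel g \<and> (translation_modulus g \<longlongrightarrow> 0) (at 0)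
              \<and> (LINT x|lborel. norm (f x - g x)) < e"
  shows "(translation_modulus f \<longlongrightarrow> 0) (at 0)"
proof (rule tendstoI)
  fix e :: real assume "e > 0"
  then obtain g :: "'a \<Rightarrow> 'b" where g: "integrable lborel g" "(translation_modulus g \<longlongrightarrow> 0) (at 0)"
      "(LINT x|lborel. norm (f x - g x)) < e / 4"
    using ex[of "e / 4"] by auto
  have "eventually (\<lambda>r. dist (translation_modulus g r) 0 < e / 2) (at 0)"
    using g(2) \<open>e > 0\<close> by (intro tendstoD) auto
  then show "eventually (\<lambda>r. dist (translation_modulus f r) 0 < e) (at 0)"
  proof eventually_elim
    case (elim r)
    then show ?case
      using translation_modulus_perturb[OF f g(1), of r] g(3)
        translation_modulus_nonneg[of f r] translation_modulus_nonneg[of g r]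
      by (simp add: dist_real_def)
  qed
qed

text \<open>Since \<open>U\<close> and its translate have equal measure, it suffices to control
the part of \<open>U\<close> that leaves its translate, and openness makes that part vanish pointwise in the limit.\<close>

lemma translation_modulus_open:
  fixes U :: "'a::euclidean_space set"
  assumes "open U" and fin: "emeasure lborel U < \<infinity>"
  shows "(translation_modulus (\<lambda>x. indicator U x *\<^sub>R (c :: 'b::{banach, second_countable_topology})) \<longlongrightarrow> 0) (at 0)"
proof -
  have [measurable]: "U \<in> sets borel" using \<open>open U\<close> by simp
  have int: "integrable lborel (indicator U :: 'a \<Rightarrow> real)"
    using fin by (simp add: integrable_indicator_iff)
  note int' = integrable_lborel_translate[OF int]
  have int2: "integrable lborel (\<lambda>x. indicator U x * (1 - indicator U (x + r) :: real))" for r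
    by (rule Bochner_Integration.integrable_bound[OF int]) (auto simp: indicator_def)
  have eq: "translation_modulus (\<lambda>x. indicator U x *\<^sub>R c) r
      = norm c * (2 * (LINT x|lborel. indicator U x * (1 - indicator U (x + r))))" for r
  proof -
    have "translation_modulus (\<lambda>x. indicator U x *\<^sub>R c) r
        = (LINT x|lborel. norm c * (2 * (indicator U x * (1 - indicator U (x + r)))
             + (indicator U (x + r) - indicator U x)))"
      unfolding translation_modulus_def
      by (rule Bochner_Integration.integral_cong) (auto simp: indicator_def)
    also have "\<dots> = norm c * (2 * (LINT x|lborel. indicator U x * (1 - indicator U (x + r)))
        + ((LINT x|lborel. indicator U (x + r)) - (LINT x|lborel. indicator U x)))"
      using int int' int2 by (subst integral_mult_right_zero) (simp del: right_diff_distrib)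
    also have "(LINT x|lborel. indicator U (x + r) :: real) = (LINT x|lborel. indicator U x)"
      by (rule integral_lborel_translate) simp
    finally show ?thesis by simp
  qed
  have "((\<lambda>r. LINT x|lborel. indicator U x * (1 - indicator U (x + r) :: real)) \<longlongrightarrow>
      (LINT x|(lborel :: 'a measure). (0::real))) (at 0)"
  proof (rule integral_dominated_convergence_at[where w = "indicator U"])
    show "integrable lborel (indicator U :: 'a \<Rightarrow> real)" by (fact int)
    show "AE x in lborel. ((\<lambda>r. indicator U x * (1 - indicator U (x + r) :: real)) \<longlongrightarrow> 0) (at 0)"
    proof (rule AE_I2)
      fix x :: 'a
      show "((\<lambda>r. indicator U x * (1 - indicator U (x + r) :: real)) \<longlongrightarrow> 0) (at 0)"
      proof (cases "x \<in> U")
        case True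
        have "((\<lambda>r. x + r) \<longlongrightarrow> x + 0) (at 0)" by (intro tendsto_intros)
        then have "eventually (\<lambda>r. x + r \<in> U) (at 0)"
          using \<open>open U\<close> True by (auto dest: topological_tendstoD)
        then show ?thesis
          using True by (intro tendsto_eventually) (erule eventually_mono, simp)
      qed auto
    qed
  qed (auto simp: indicator_def)
  then show ?thesis unfolding eq by (auto intro!: tendsto_eq_intros)
qed

text \<open>Outer regularity reduces indicators of Borel sets to those of open sets.\<close>

theorem translation_modulus_tendsto_0:
  fixes f :: "'a::euclidean_space \<Rightarrow> 'b::{banach, second_countable_topology}"
  assumes "integrable lborel f"
  shows "(translation_modulus f \<longlongrightarrow> 0) (at 0)"
  using assms
proof (induction rule: integrable_induct)
  case (base A c)
  then have [measurable]: "A \<in> sets borel" by simp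
  have intA: "integrable lborel (\<lambda>x. indicator A x *\<^sub>R c)"
    using base by (intro integrable_scaleR_left integrable_real_indicator) auto
  show ?case
  proof (rule translation_modulus_approx[OF intA])
    fix e :: real assume "e > 0"
    define d where "d = e / (norm c + 1)"
    have "d > 0" using \<open>e > 0\<close> by (simp add: d_def add_nonneg_pos)
    obtain U where U: "open U" "A \<subseteq> U" "emeasure lborel (U - A) < ennreal d"
      using outer_regular_lborel[of A d] \<open>d > 0\<close> by auto
    have [measurable]: "U \<in> sets borel" using U by simp
    have fin: "emeasure lborel U < \<infinity>"
    proof -
      have "emeasure lborel U = emeasure lborel (A \<union> (U - A))" using U(2) by (simp add: Un_absorb1)
      also have "\<dots> \<le> emeasure lborel A + emeasure lborel (U - A)"
        by (rule emeasure_subadditive) auto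
      also have "\<dots> < \<infinity>" using U(3) base(2) by (auto simp: less_top[symmetric])
      finally show ?thesis .
    qed
    have "(LINT x|lborel. norm (indicator A x *\<^sub>R c - indicator U x *\<^sub>R c))
        = (LINT x|lborel. norm c * indicator (U - A) x)"
      using U(2) by (intro Bochner_Integration.integral_cong) (auto simp: indicator_def)
    also have "\<dots> = norm c * measure lborel (U - A)" by simp
    also have "\<dots> \<le> norm c * d"
      using U(3) \<open>d > 0\<close>
      by (intro mult_left_mono)
        (auto simp: measure_def enn2real_leI less_imp_le)
    also have "\<dots> < (norm c + 1) * d" using \<open>d > 0\<close> by simp
    also have "\<dots> = e" by (simp add: d_def add_nonneg_eq_0_iff)
    finally show "\<exists>g. integrable lborel g \<and> (translation_modulus g \<longlongrightarrow> 0) (at 0)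
        \<and> (LINT x|lborel. norm (indicator A x *\<^sub>R c - g x)) < e"
      using translation_modulus_open[OF U(1) fin, of c] fin
      by (intro exI[of _ "\<lambda>x. indicator U x *\<^sub>R c"])
        (auto intro!: integrable_scaleR_left integrable_real_indicator)
  qed
next
  case (add f g)
  show ?case
  proof (rule Lim_null_comparison)
    show "eventually (\<lambda>r. norm (translation_modulus (\<lambda>x. f x + g x) r)
        \<le> translation_modulus f r + translation_modulus g r) (at 0)"
    proof (rule always_eventually, rule allI)
      fix r
      note [simp] = integrable_lborel_translate[OF add.hyps(1)] integrable_lborel_translate[OF add.hyps(2)] add.hyps
      have "translation_modulus (\<lambda>x. f x + g x) r
          \<le> (LINT x|lborel. norm (f (x + r) - f x) + norm (g (x + r) - g x))"
        unfolding translation_modulus_def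
        by (intro integral_mono integrable_norm Bochner_Integration.integrable_diff
            Bochner_Integration.integrable_add integrable_norm)
          (auto intro: norm_diff_triangle_ineq)
      also have "\<dots> = translation_modulus f r + translation_modulus g r"
        unfolding translation_modulus_def
        by (intro Bochner_Integration.integral_add integrable_norm
            Bochner_Integration.integrable_diff) auto
      finally show "norm (translation_modulus (\<lambda>x. f x + g x) r)
        \<le> translation_modulus f r + translation_modulus g r"
        by (simp add: translation_modulus_nonneg)
    qed
    show "((\<lambda>r. translation_modulus f r + translation_modulus g r) \<longlongrightarrow> 0) (at 0)"
      using tendsto_add[OF add.IH] by simp
  qed
next
  case (lim f s)
  have [measurable]: "f \<in> borel_measurable borel" "\<And>i. s i \<in> borel_measurable borel"
    using lim by (auto simp: borel_measurable_integrable)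
  have "(\<lambda>i. LINT x|lborel. norm (f x - s i x)) \<longlonglongrightarrow> (LINT x|lborel. norm (f x - f x))"
  proof (rule integral_dominated_convergence)
    show "integrable lborel (\<lambda>x. 3 * norm (f x))" using lim by simp
    show "AE x in lborel. (\<lambda>i. norm (f x - s i x)) \<longlonglongrightarrow> norm (f x - f x)"
      using lim by (intro AE_I2 tendsto_intros) auto
    show "AE x in lborel. norm (norm (f x - s i x)) \<le> 3 * norm (f x)" for i
    proof (rule AE_I2)
      fix x
      show "norm (norm (f x - s i x)) \<le> 3 * norm (f x)"
        using lim.hyps(3)[of x i] norm_triangle_ineq4[of "f x" "s i x"] by simp
    qed
  qed auto
  then have L: "(\<lambda>i. LINT x|lborel. norm (f x - s i x)) \<longlonglongrightarrow> 0" by simp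
  show ?case
  proof (rule translation_modulus_approx)
    fix e :: real assume "e > 0"
    then obtain i where "norm ((LINT x|lborel. norm (f x - s i x)) - 0) < e"
      using LIMSEQ_D[OF L] by blast
    then show "\<exists>g. integrable lborel g \<and> (translation_modulus g \<longlongrightarrow> 0) (at 0)
        \<and> (LINT x|lborel. norm (f x - g x)) < e"
      using lim by (intro exI[of _ "s i"]) auto
  qed (use lim in auto)
qed

section \<open>The Fourier transform on the line\<close>

lemma borel_measurable_cis [measurable]: "cis \<in> borel_measurable borel"
  by (intro borel_measurable_continuous_onI continuous_intros)

lemma borel_measurable_cnj [measurable]: "cnj \<in> borel_measurable borel"
  by (intro borel_measurable_continuous_onI continuous_intros)

definition fourier1 :: "(real \<Rightarrow> complex) \<Rightarrow> real \<Rightarrow> complex" where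
  "fourier1 \<phi> \<omega> = (LINT t|lborel. \<phi> t * cis (- 2 * pi * t * \<omega>))"

lemma integrable_cis_mult:
  assumes "integrable M \<phi>" and [measurable]: "\<theta> \<in> borel_measurable M"
  shows "integrable M (\<lambda>t. \<phi> t * cis (\<theta> t))"
proof -
  have [measurable]: "\<phi> \<in> borel_measurable M" using assms(1) by (rule borel_measurable_integrable)
  show ?thesis
    by (rule Bochner_Integration.integrable_bound[OF assms(1)]) (auto simp: norm_mult)
qed

lemma norm_fourier1_le:
  assumes "integrable lborel \<phi>"
  shows "cmod (fourier1 \<phi> \<omega>) \<le> (LINT t|lborel. cmod (\<phi> t))"
  unfolding fourier1_def by (rule integral_norm_bound[THEN order_trans]) (simp add: norm_mult)

lemma borel_measurable_fourier1 [measurable]: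
  assumes [measurable]: "\<phi> \<in> borel_measurable borel"
  shows "fourier1 \<phi> \<in> borel_measurable borel"
  unfolding fourier1_def by measurable

lemma (in pair_sigma_finite) integrable_mult_pair:
  fixes f :: "'a \<Rightarrow> complex" and g :: "'b \<Rightarrow> complex"
  assumes f: "integrable M1 f" and g: "integrable M2 g"
  shows "integrable (M1 \<Otimes>\<^sub>M M2) (\<lambda>(x, y). f x * g y)"
proof (rule Fubini_integrable)
  have [measurable]: "f \<in> borel_measurable M1" "g \<in> borel_measurable M2" using assms by auto
  show "(\<lambda>(x, y). f x * g y) \<in> borel_measurable (M1 \<Otimes>\<^sub>M M2)" by measurable
  show "integrable M1 (\<lambda>x. LINT y|M2. cmod (case (x, y) of (x, y) \<Rightarrow> f x * g y))"
    using f by (simp add: norm_mult)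
  show "AE x in M1. integrable M2 (\<lambda>y. case (x, y) of (x, y) \<Rightarrow> f x * g y)"
    using g by simp
qed

text \<open>Both sides are the iterated integrals of one integrable function of two variables.\<close>

lemma fourier1_multiplication_formula:
  assumes "integrable lborel \<phi>" "integrable lborel m"
  shows "(LINT \<omega>|lborel. fourier1 \<phi> \<omega> * m \<omega>) = (LINT t|lborel. \<phi> t * fourier1 m t)"
proof -
  have [measurable]: "\<phi> \<in> borel_measurable borel" "m \<in> borel_measurable borel"
    using assms[THEN borel_measurable_integrable] by simp_all
  have int: "integrable (lborel \<Otimes>\<^sub>M lborel) (\<lambda>(\<omega>, t). m \<omega> * \<phi> t * cis (- 2 * pi * t * \<omega>))"
    using integrable_cis_mult[OF lborel_pair.integrable_mult_pair[OF assms(2,1)],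
        of "\<lambda>(\<omega>, t). - 2 * pi * t * \<omega>"]
    by (simp add: case_prod_beta')
  have "(LINT \<omega>|lborel. fourier1 \<phi> \<omega> * m \<omega>)
      = (LINT \<omega>|lborel. LINT t|lborel. m \<omega> * \<phi> t * cis (- 2 * pi * t * \<omega>))"
    unfolding fourier1_def
    by (intro Bochner_Integration.integral_cong refl, subst integral_mult_left_zero[symmetric])
      (simp add: mult_ac)
  also have "\<dots> = (LINT t|lborel. LINT \<omega>|lborel. m \<omega> * \<phi> t * cis (- 2 * pi * t * \<omega>))"
    by (rule lborel_pair.Fubini_integral[OF int, symmetric])
  also have "\<dots> = (LINT t|lborel. \<phi> t * fourier1 m t)"
    unfolding fourier1_def
    by (intro Bochner_Integration.integral_cong refl, subst integral_mult_right_zero[symmetric])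
      (simp add: mult_ac)
  finally show ?thesis .
qed

text \<open>The summability kernel: as \<open>\<delta>\<close> decreases to \<open>0\<close> it increases to \<open>1\<close>, while its Fourier transform concentrates
at the origin.\<close>

definition gauss :: "real \<Rightarrow> real \<Rightarrow> complex" where
  "gauss \<delta> \<omega> = complex_of_real (exp (- pi * (\<delta> * \<omega>)\<^sup>2))"

lemma borel_measurable_gauss [measurable]: "gauss \<delta> \<in> borel_measurable borel"
  unfolding gauss_def by measurable

lemma
  assumes "\<delta> > 0"
  shows integrable_gauss: "integrable lborel (gauss \<delta>)"
    and fourier1_gauss: "fourier1 (gauss \<delta>) t = gauss (1 / \<delta>) t / complex_of_real \<delta>"
proof -
  define c where "c = sqrt (2 * pi) * \<delta>"
  have c: "c > 0" using assms by (simp add: c_def)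
  define s where "s = - sqrt (2 * pi) * t / \<delta>"
  have sq: "(sqrt (2 * pi))\<^sup>2 = 2 * pi" by simp
  have dens: "std_normal_density (0 + c * \<omega>) = exp (- pi * (\<delta> * \<omega>)\<^sup>2) / sqrt (2 * pi)" for \<omega>
    by (simp add: std_normal_density_def c_def power_mult_distrib)
  have "integrable lborel std_normal_density"
    by simp
  then have "integrable lborel (\<lambda>\<omega>. std_normal_density (0 + c * \<omega>))"
    using c by (intro lborel_integrable_real_affine) auto
  then have "integrable lborel (\<lambda>\<omega>. exp (- pi * (\<delta> * \<omega>)\<^sup>2) / sqrt (2 * pi))"
    unfolding dens .
  then have "integrable lborel (\<lambda>\<omega>. sqrt (2 * pi) * (exp (- pi * (\<delta> * \<omega>)\<^sup>2) / sqrt (2 * pi)))"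
    by (rule integrable_mult_right)
  moreover have "(\<lambda>\<omega>. sqrt (2 * pi) * (exp (- pi * (\<delta> * \<omega>)\<^sup>2) / sqrt (2 * pi)))
      = (\<lambda>\<omega>. exp (- pi * (\<delta> * \<omega>)\<^sup>2))"
    by (intro ext) simp
  ultimately have "integrable lborel (\<lambda>\<omega>. exp (- pi * (\<delta> * \<omega>)\<^sup>2))"
    by (simp only:)
  then show "integrable lborel (gauss \<delta>)"
    unfolding gauss_def by (rule integrable_of_real)
  have "complex_of_real (exp (- s\<^sup>2 / 2)) = char std_normal_distribution s"
    by (simp add: char_std_normal_distribution)
  also have "\<dots> = (LINT x|lborel. std_normal_density x *\<^sub>R iexp (s * x))"
    unfolding char_def by (subst integral_density) auto
  also have "\<dots> = \<bar>c\<bar> *\<^sub>R (LINT \<omega>|lborel. std_normal_density (0 + c * \<omega>) *\<^sub>R iexp (s * (0 + c * \<omega>)))"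
    using c by (intro lborel_integral_real_affine) auto
  also have "\<dots> = \<bar>c\<bar> *\<^sub>R (LINT \<omega>|lborel. complex_of_real (1 / sqrt (2 * pi)) * (gauss \<delta> \<omega> * cis (- 2 * pi * \<omega> * t)))"
  proof -
    have "s * (0 + c * \<omega>) = - 2 * pi * \<omega> * t" for \<omega>
      using assms sq by (simp add: s_def c_def power2_eq_square) 
    then have "iexp (s * (0 + c * \<omega>)) = cis (- 2 * pi * \<omega> * t)" for \<omega>
      by (simp only: cis_conv_exp)
    then show ?thesis unfolding dens
      by (simp add: gauss_def scaleR_conv_of_real mult_ac)
  qed
  also have "\<dots> = \<delta> * fourier1 (gauss \<delta>) t"
  proof -
    have "complex_of_real (sqrt (2 * pi)) \<noteq> 0" by simp
    then show ?thesis
    using c unfolding fourier1_def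
    by (subst integral_mult_right_zero) (simp add: c_def scaleR_conv_of_real)
  qed
  finally have "fourier1 (gauss \<delta>) t = exp (- s\<^sup>2 / 2) / \<delta>"
    using assms by (simp add: field_simps)
  moreover have "- s\<^sup>2 / 2 = - pi * (1 / \<delta> * t)\<^sup>2"
    using sq by (simp add: s_def power_mult_distrib power_divide)
  ultimately show "fourier1 (gauss \<delta>) t = gauss (1 / \<delta>) t / complex_of_real \<delta>"
    by (simp add: gauss_def)
qed

lemma integral_gauss_1: "(LINT r|lborel. gauss 1 r) = 1"
  using fourier1_gauss[of 1 0] by (simp add: fourier1_def gauss_def)

lemma gauss_tendsto_1: "(\<lambda>n. gauss (inverse (real (Suc n))) \<omega>) \<longlonglongrightarrow> 1"
proof -
  have "(\<lambda>n. exp (- pi * (inverse (real (Suc n)) * \<omega>)\<^sup>2)) \<longlonglongrightarrow> exp (- pi * (0 * \<omega>)\<^sup>2)"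
    by (intro tendsto_intros LIMSEQ_inverse_real_of_nat)
  from tendsto_of_real[OF this] show ?thesis
    unfolding gauss_def by simp
qed

section \<open>Plancherel's formula for autocorrelations\<close>

definition autocorr :: "(real \<Rightarrow> complex) \<Rightarrow> real \<Rightarrow> complex" where
  "autocorr \<phi> x = (LINT t|lborel. \<phi> (t + x) * cnj (\<phi> t))"

text \<open>The free weight replaces the Cauchy-Schwarz inequality: either factor can be made to count as little as desired.\<close>

lemma mult_le_weighted_squares:
  fixes a b :: real
  assumes "\<kappa> > 0"
  shows "a * b \<le> (\<kappa> * a\<^sup>2 + b\<^sup>2 / \<kappa>) / 2"
proof -
  have "0 \<le> (sqrt \<kappa> * a - b / sqrt \<kappa>)\<^sup>2" by simp
  also have "\<dots> = \<kappa> * a\<^sup>2 + b\<^sup>2 / \<kappa> - 2 * (a * b)"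
    using assms by (simp add: power2_diff power_mult_distrib power_divide)
  finally show ?thesis by simp
qed

lemma integrable_mult_L2:
  fixes u v :: "'a \<Rightarrow> complex"
  assumes [measurable]: "u \<in> borel_measurable M" "v \<in> borel_measurable M"
    and u: "integrable M (\<lambda>t. (cmod (u t))\<^sup>2)" and v: "integrable M (\<lambda>t. (cmod (v t))\<^sup>2)"
  shows "integrable M (\<lambda>t. u t * v t)"
proof (rule Bochner_Integration.integrable_bound)
  show "integrable M (\<lambda>t. (cmod (u t))\<^sup>2 + (cmod (v t))\<^sup>2)" using u v by simp
  have "cmod (u t) * cmod (v t) \<le> (cmod (u t))\<^sup>2 + (cmod (v t))\<^sup>2" for t
  proof -
    have "0 \<le> (cmod (u t))\<^sup>2 + (cmod (v t))\<^sup>2" by simp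
    moreover have "cmod (u t) * cmod (v t) \<le> ((cmod (u t))\<^sup>2 + (cmod (v t))\<^sup>2) / 2"
      using mult_le_weighted_squares[of 1 "cmod (u t)" "cmod (v t)"] by simp
    ultimately show ?thesis using order_trans[of _ "_ / 2"] by (rule_tac order_trans[of _ "((cmod (u t))\<^sup>2 + (cmod (v t))\<^sup>2) / 2"]) auto
  qed
  then show "AE t in M. cmod (u t * v t) \<le> norm ((cmod (u t))\<^sup>2 + (cmod (v t))\<^sup>2)"
    by (simp add: norm_mult)
qed measurable

lemma norm_integral_mult_L2_le:
  fixes u v :: "'a \<Rightarrow> complex"
  assumes [measurable]: "u \<in> borel_measurable M" "v \<in> borel_measurable M"
    and u: "integrable M (\<lambda>t. (cmod (u t))\<^sup>2)" and v: "integrable M (\<lambda>t. (cmod (v t))\<^sup>2)"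
    and "\<kappa> > 0"
  shows "cmod (LINT t|M. u t * v t) \<le> (\<kappa> * (LINT t|M. (cmod (u t))\<^sup>2) + (LINT t|M. (cmod (v t))\<^sup>2) / \<kappa>) / 2"
proof -
  have "cmod (LINT t|M. u t * v t) \<le> (LINT t|M. cmod (u t * v t))"
    by (rule integral_norm_bound)
  also have "\<dots> \<le> (LINT t|M. (\<kappa> * (cmod (u t))\<^sup>2 + (cmod (v t))\<^sup>2 / \<kappa>) / 2)"
  proof (rule integral_mono)
    show "integrable M (\<lambda>t. cmod (u t * v t))"
      by (intro integrable_norm integrable_mult_L2 assms)
    show "cmod (u t * v t) \<le> (\<kappa> * (cmod (u t))\<^sup>2 + (cmod (v t))\<^sup>2 / \<kappa>) / 2" for t
      using mult_le_weighted_squares[OF \<open>\<kappa> > 0\<close>] by (simp only: norm_mult)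
  qed (use u v in auto)
  also have "\<dots> = (\<kappa> * (LINT t|M. (cmod (u t))\<^sup>2) + (LINT t|M. (cmod (v t))\<^sup>2) / \<kappa>) / 2"
    using u v by simp
  finally show ?thesis .
qed

context
  fixes \<phi> :: "real \<Rightarrow> complex"
  assumes L1: "integrable lborel \<phi>" and L2: "integrable lborel (\<lambda>t. (cmod (\<phi> t))\<^sup>2)"
begin

lemma borel_measurable_L1 [measurable]: "\<phi> \<in> borel_measurable borel"
  using borel_measurable_integrable[OF L1] by simp

lemma norm_autocorr_le: "cmod (autocorr \<phi> x) \<le> (LINT t|lborel. (cmod (\<phi> t))\<^sup>2)"
proof -
  have "(LINT t|lborel. (cmod (\<phi> (t + x)))\<^sup>2) = (LINT t|lborel. (cmod (\<phi> t))\<^sup>2)"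
    by (rule integral_lborel_translate[where f = "\<lambda>t. (cmod (\<phi> t))\<^sup>2"]) measurable
  moreover have "integrable lborel (\<lambda>t. (cmod (\<phi> (t + x)))\<^sup>2)"
    by (rule integrable_lborel_translate[OF L2])
  ultimately show ?thesis
    using norm_integral_mult_L2_le[of "\<lambda>t. \<phi> (t + x)" lborel "\<lambda>t. cnj (\<phi> t)" 1] L2
    by (simp add: autocorr_def)
qed

lemma borel_measurable_autocorr [measurable]: "autocorr \<phi> \<in> borel_measurable borel"
  unfolding autocorr_def by measurable

text \<open>Truncating one of the two factors changes the autocorrelation little, uniformly in the
shift. Once that factor is bounded, continuity of translations of the other factor in \<open>L\<^sup>1\<close> is enough.\<close>

lemma isCont_autocorr: "isCont (autocorr \<phi>) x"
  unfolding isCont_iff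
proof (rule tendstoI)
  fix e :: real assume "e > 0"
  define K where "K = (LINT t|lborel. (cmod (\<phi> t))\<^sup>2)"
  have "K \<ge> 0" unfolding K_def by (intro integral_nonneg_AE) auto
  \<comment> \<open>The weight makes the untruncated factor contribute little; the truncation level \<open>M\<close> is then chosen to outweigh \<open>1 / \<kappa>\<close>.\<close>
  define \<kappa> where "\<kappa> = e / (4 * (K + 1))"
  have "\<kappa> > 0" using \<open>e > 0\<close> \<open>K \<ge> 0\<close> by (simp add: \<kappa>_def)
  have "\<kappa> * K \<le> \<kappa> * (K + 1)" using \<open>\<kappa> > 0\<close> by simp
  also have "\<dots> = e / 4"
  proof -
    have "K + 1 \<noteq> 0" using \<open>K \<ge> 0\<close> by simp
    then show ?thesis unfolding \<kappa>_def by (metis divide_divide_eq_left nonzero_divide_eq_eq times_divide_eq_left mult.commute)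
  qed
  finally have \<kappa>K: "\<kappa> * K \<le> e / 4" .
  define cut where "cut M t = (if cmod (\<phi> t) \<le> real M then \<phi> t else 0)" for M t
  have [measurable]: "cut M \<in> borel_measurable borel" for M
    unfolding cut_def by measurable
  have le: "(cmod (\<phi> t - cut M t))\<^sup>2 \<le> (cmod (\<phi> t))\<^sup>2" for M t by (simp add: cut_def)
  have intdiff: "integrable lborel (\<lambda>t. (cmod (\<phi> t - cut M t))\<^sup>2)" for M
    using le by (intro Bochner_Integration.integrable_bound[OF L2]) auto
  have "(\<lambda>M. LINT t|lborel. (cmod (\<phi> t - cut M t))\<^sup>2) \<longlonglongrightarrow> (LINT t|(lborel::real measure). 0)"
  proof (rule integral_dominated_convergence[OF _ _ L2])
    show "AE t in lborel. (\<lambda>M. (cmod (\<phi> t - cut M t))\<^sup>2) \<longlonglongrightarrow> 0"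
    proof (rule AE_I2)
      fix t
      obtain N :: nat where "cmod (\<phi> t) \<le> real N" using real_arch_simple by blast
      then have "eventually (\<lambda>M. (cmod (\<phi> t - cut M t))\<^sup>2 = 0) sequentially"
        by (intro eventually_sequentiallyI[of N]) (auto simp: cut_def)
      then show "(\<lambda>M. (cmod (\<phi> t - cut M t))\<^sup>2) \<longlonglongrightarrow> 0" by (rule tendsto_eventually)
    qed
  qed (use le in auto)
  moreover have "\<kappa> * e / 4 > 0" using \<open>e > 0\<close> \<open>\<kappa> > 0\<close> by simp
  ultimately have "eventually (\<lambda>M. (LINT t|lborel. (cmod (\<phi> t - cut M t))\<^sup>2) < \<kappa> * e / 4) sequentially"
    by (intro order_tendstoD(2)) auto
  then obtain M where M: "(LINT t|lborel. (cmod (\<phi> t - cut M t))\<^sup>2) < \<kappa> * e / 4"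
    by (auto simp: eventually_sequentially)
  define a where "a y = (LINT t|lborel. \<phi> (t + y) * cnj (cut M t))" for y
  have L2': "integrable lborel (\<lambda>t. (cmod (\<phi> (t + y)))\<^sup>2)" for y
    by (rule integrable_lborel_translate[OF L2])
  have L2cut: "integrable lborel (\<lambda>t. (cmod (cut M t))\<^sup>2)"
    by (rule Bochner_Integration.integrable_bound[OF L2]) (auto simp: cut_def)
  have near: "cmod (autocorr \<phi> y - a y) \<le> e / 4" for y
  proof -
    have "autocorr \<phi> y - a y = (LINT t|lborel. \<phi> (t + y) * cnj (\<phi> t - cut M t))"
      unfolding autocorr_def a_def
      by (subst Bochner_Integration.integral_diff[symmetric])
        (auto intro!: integrable_mult_L2 L2' simp: L2 L2cut algebra_simps)
    also have "cmod \<dots> \<le> (\<kappa> * (LINT t|lborel. (cmod (\<phi> (t + y)))\<^sup>2)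
        + (LINT t|lborel. (cmod (cnj (\<phi> t - cut M t)))\<^sup>2) / \<kappa>) / 2"
      using L2' intdiff \<open>\<kappa> > 0\<close> by (intro norm_integral_mult_L2_le) (auto simp flip: complex_cnj_diff)
    also have "(LINT t|lborel. (cmod (\<phi> (t + y)))\<^sup>2) = K"
      unfolding K_def
      by (rule integral_lborel_translate[where f = "\<lambda>t. (cmod (\<phi> t))\<^sup>2"]) measurable
    also have "(LINT t|lborel. (cmod (cnj (\<phi> t - cut M t)))\<^sup>2) / \<kappa> \<le> e / 4"
      using M \<open>\<kappa> > 0\<close> by (simp add: field_simps flip: complex_cnj_diff)
    finally show ?thesis using \<kappa>K by simp
  qed
  have shift: "cmod (a (x + h) - a x) \<le> real M * translation_modulus \<phi> h" for h
  proof -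
    have i: "integrable lborel (\<lambda>t. \<phi> (t + x + h) - \<phi> (t + x))"
      using integrable_lborel_translate[OF L1, of "x + h"] integrable_lborel_translate[OF L1, of x]
      by (simp add: add.assoc)
    have "a (x + h) - a x = (LINT t|lborel. (\<phi> (t + x + h) - \<phi> (t + x)) * cnj (cut M t))"
      unfolding a_def
      by (subst Bochner_Integration.integral_diff[symmetric])
        (auto intro!: integrable_mult_L2 L2' simp: L2cut algebra_simps)
    also have "cmod \<dots> \<le> (LINT t|lborel. real M * cmod (\<phi> (t + x + h) - \<phi> (t + x)))"
    proof (rule order_trans[OF integral_norm_bound], rule integral_mono')
      show "integrable lborel (\<lambda>t. real M * cmod (\<phi> (t + x + h) - \<phi> (t + x)))"
        using i by auto
      show "cmod ((\<phi> (t + x + h) - \<phi> (t + x)) * cnj (cut M t))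
          \<le> real M * cmod (\<phi> (t + x + h) - \<phi> (t + x))" for t
        by (auto simp: norm_mult cut_def mult.commute intro: mult_right_mono)
    qed auto
    also have "\<dots> = real M * (LINT t|lborel. cmod (\<phi> (t + x + h) - \<phi> (t + x)))" by simp
    also have "(LINT t|lborel. cmod (\<phi> (t + x + h) - \<phi> (t + x))) = translation_modulus \<phi> h"
      unfolding translation_modulus_def
      by (rule integral_lborel_translate[where f = "\<lambda>t. cmod (\<phi> (t + h) - \<phi> t)"]) measurable
    finally show ?thesis .
  qed
  have "((\<lambda>h. real M * translation_modulus \<phi> h) \<longlongrightarrow> real M * 0) (at 0)"
    by (intro tendsto_intros translation_modulus_tendsto_0 L1)
  then have "eventually (\<lambda>h. real M * translation_modulus \<phi> h < e / 4) (at 0)"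
    using \<open>e > 0\<close> by (intro order_tendstoD(2)) auto
  then show "eventually (\<lambda>h. dist (autocorr \<phi> (x + h)) (autocorr \<phi> x) < e) (at 0)"
  proof eventually_elim
    case (elim h)
    have "cmod (autocorr \<phi> (x + h) - autocorr \<phi> x)
        \<le> cmod (autocorr \<phi> (x + h) - a (x + h)) + cmod (a (x + h) - a x) + cmod (autocorr \<phi> x - a x)"
    proof -
      have "autocorr \<phi> (x + h) - autocorr \<phi> x
          = (autocorr \<phi> (x + h) - a (x + h)) + (a (x + h) - a x) - (autocorr \<phi> x - a x)"
        by simp
      then show ?thesis
        using norm_triangle_ineq4[of "(autocorr \<phi> (x + h) - a (x + h)) + (a (x + h) - a x)" "autocorr \<phi> x - a x"]
          norm_triangle_ineq[of "autocorr \<phi> (x + h) - a (x + h)" "a (x + h) - a x"] by simp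
    qed
    then show ?case
      using near[of "x + h"] near[of x] shift[of h] elim \<open>e > 0\<close> by (simp add: dist_norm)
  qed
qed

text \<open>The multiplication formula is used twice, once for each factor of \<open>\<bar>fourier1 \<phi>\<bar>\<^sup>2\<close>; the second use brings in the Fourier
transform of the modulated Gaussian, and rescaling it turns the result into an average of autocorrelations near \<open>x\<close>.\<close>

lemma regularised_plancherel:
  assumes "\<delta> > 0"
  shows "(LINT \<omega>|lborel. complex_of_real ((cmod (fourier1 \<phi> \<omega>))\<^sup>2) * cis (2 * pi * \<omega> * x) * gauss \<delta> \<omega>)
      = (LINT r|lborel. gauss 1 r * autocorr \<phi> (x + \<delta> * r))"
proof -
  have ig: "integrable lborel (gauss \<delta>)" and ig1: "integrable lborel (gauss 1)"
    using assms by (auto intro: integrable_gauss)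
  define m where "m \<omega> = cnj (fourier1 \<phi> \<omega>) * (gauss \<delta> \<omega> * cis (2 * pi * \<omega> * x))" for \<omega>
  have [measurable]: "m \<in> borel_measurable borel" unfolding m_def by measurable
  define B where "B = (LINT t|lborel. cmod (\<phi> t))"
  have int_m: "integrable lborel m"
  proof (rule Bochner_Integration.integrable_bound)
    show "integrable lborel (\<lambda>\<omega>. B * cmod (gauss \<delta> \<omega>))" using ig by auto
    show "AE \<omega> in lborel. cmod (m \<omega>) \<le> norm (B * cmod (gauss \<delta> \<omega>))"
      using norm_fourier1_le[OF L1]
      by (intro AE_I2) (auto simp: m_def norm_mult B_def abs_mult
          intro!: mult_right_mono order_trans[OF _ abs_ge_self])
  qed measurable
  have fm: "fourier1 m t = cnj (LINT r|lborel. \<phi> (t - x - \<delta> * r) * gauss 1 r)" for t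
  proof -
    have "fourier1 m t = cnj (LINT \<omega>|lborel. fourier1 \<phi> \<omega> * (gauss \<delta> \<omega> * cis (2 * pi * \<omega> * (t - x))))"
    proof -
      have "m \<omega> * cis (- 2 * pi * \<omega> * t)
          = cnj (fourier1 \<phi> \<omega> * (gauss \<delta> \<omega> * cis (2 * pi * \<omega> * (t - x))))" for \<omega>
      proof -
        have "cis (2 * pi * \<omega> * x) * cis (- 2 * pi * \<omega> * t) = cis (- (2 * pi * \<omega> * (t - x)))"
          by (simp add: cis_mult algebra_simps)
        then show ?thesis by (simp add: m_def gauss_def cis_cnj mult.assoc)
      qed
      then show ?thesis unfolding fourier1_def[of m] by (simp only: Bochner_Integration.integral_cnj)
    qed
    also have "(LINT \<omega>|lborel. fourier1 \<phi> \<omega> * (gauss \<delta> \<omega> * cis (2 * pi * \<omega> * (t - x))))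
        = (LINT t'|lborel. \<phi> t' * fourier1 (\<lambda>\<omega>. gauss \<delta> \<omega> * cis (2 * pi * \<omega> * (t - x))) t')"
      by (intro fourier1_multiplication_formula L1 integrable_cis_mult ig) measurable
    also have "\<dots> = (LINT t'|lborel. \<phi> t' * (gauss 1 ((t' - (t - x)) / \<delta>) / complex_of_real \<delta>))"
    proof (intro Bochner_Integration.integral_cong refl)
      fix t'
      have "fourier1 (\<lambda>\<omega>. gauss \<delta> \<omega> * cis (2 * pi * \<omega> * (t - x))) t' = fourier1 (gauss \<delta>) (t' - (t - x))"
        unfolding fourier1_def mult.assoc cis_mult
        by (intro Bochner_Integration.integral_cong refl arg_cong2[of _ _ _ _ "(*)"] arg_cong[of _ _ cis])
          (simp add: algebra_simps)
      then show "\<phi> t' * fourier1 (\<lambda>\<omega>. gauss \<delta> \<omega> * cis (2 * pi * \<omega> * (t - x))) t'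
          = \<phi> t' * (gauss 1 ((t' - (t - x)) / \<delta>) / complex_of_real \<delta>)"
        using assms by (simp add: fourier1_gauss gauss_def)
    qed
    also have "\<dots> = \<bar>- \<delta>\<bar> *\<^sub>R (LINT r|lborel. \<phi> ((t - x) + (- \<delta>) * r)
        * (gauss 1 (((t - x) + (- \<delta>) * r - (t - x)) / \<delta>) / complex_of_real \<delta>))"
      using assms by (intro lborel_integral_real_affine) auto
    also have "\<dots> = (LINT r|lborel. \<phi> (t - x - \<delta> * r) * gauss 1 r)"
      using assms
      by (subst integral_scaleR_right[symmetric])
        (auto intro!: Bochner_Integration.integral_cong simp: scaleR_conv_of_real gauss_def)
    finally show ?thesis .
  qed
  have "(LINT \<omega>|lborel. complex_of_real ((cmod (fourier1 \<phi> \<omega>))\<^sup>2) * cis (2 * pi * \<omega> * x) * gauss \<delta> \<omega>)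
      = (LINT \<omega>|lborel. fourier1 \<phi> \<omega> * m \<omega>)"
    by (intro Bochner_Integration.integral_cong refl)
      (simp add: m_def complex_norm_square mult_ac del: of_real_power)
  also have "\<dots> = (LINT t|lborel. \<phi> t * fourier1 m t)"
    by (rule fourier1_multiplication_formula[OF L1 int_m])
  also have "\<dots> = (LINT t|lborel. LINT r|lborel. \<phi> t * cnj (\<phi> (t - x - \<delta> * r)) * gauss 1 r)"
  proof (intro Bochner_Integration.integral_cong refl)
    fix t
    have "\<phi> t * fourier1 m t = \<phi> t * (LINT r|lborel. cnj (\<phi> (t - x - \<delta> * r) * gauss 1 r))"
      unfolding fm by (subst Bochner_Integration.integral_cnj) simp
    also have "\<dots> = (LINT r|lborel. \<phi> t * cnj (\<phi> (t - x - \<delta> * r) * gauss 1 r))"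
      by simp
    also have "\<dots> = (LINT r|lborel. \<phi> t * cnj (\<phi> (t - x - \<delta> * r)) * gauss 1 r)"
      by (intro Bochner_Integration.integral_cong refl) (simp add: gauss_def)
    finally show "\<phi> t * fourier1 m t = (LINT r|lborel. \<phi> t * cnj (\<phi> (t - x - \<delta> * r)) * gauss 1 r)" .
  qed
  also have "\<dots> = (LINT r|lborel. LINT t|lborel. \<phi> t * cnj (\<phi> (t - x - \<delta> * r)) * gauss 1 r)"
  proof (rule lborel_pair.Fubini_integral)
    show "integrable (lborel \<Otimes>\<^sub>M lborel) (\<lambda>(r, t). \<phi> t * cnj (\<phi> (t - x - \<delta> * r)) * gauss 1 r)"
    proof (rule lborel_pair.Fubini_integrable)
      have i2: "integrable lborel (\<lambda>t. \<phi> t * cnj (\<phi> (t - x - \<delta> * r)))" for r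
        using integrable_lborel_translate[OF L2, of "- x - \<delta> * r"]
        by (intro integrable_mult_L2) (auto simp: L2 algebra_simps)
      show "AE r in lborel. integrable lborel (\<lambda>t. case (r, t) of (r, t) \<Rightarrow> \<phi> t * cnj (\<phi> (t - x - \<delta> * r)) * gauss 1 r)"
        using i2 by simp
      define K where "K = (LINT t|lborel. (cmod (\<phi> t))\<^sup>2)"
      show "integrable lborel (\<lambda>r. LINT t|lborel. cmod (case (r, t) of (r, t) \<Rightarrow> \<phi> t * cnj (\<phi> (t - x - \<delta> * r)) * gauss 1 r))"
      proof (rule Bochner_Integration.integrable_bound)
        show "integrable lborel (\<lambda>r. K * cmod (gauss 1 r))" using ig1 by auto
        show "AE r in lborel. norm (LINT t|lborel. cmod (case (r, t) of (r, t) \<Rightarrow> \<phi> t * cnj (\<phi> (t - x - \<delta> * r)) * gauss 1 r))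
            \<le> norm (K * cmod (gauss 1 r))"
        proof (rule AE_I2)
          fix r
          have "(LINT t|lborel. cmod (\<phi> t * cnj (\<phi> (t - x - \<delta> * r))))
              \<le> (LINT t|lborel. ((cmod (\<phi> t))\<^sup>2 + (cmod (\<phi> (t + (- x - \<delta> * r))))\<^sup>2) / 2)"
          proof (rule integral_mono)
            show "integrable lborel (\<lambda>t. cmod (\<phi> t * cnj (\<phi> (t - x - \<delta> * r))))"
              by (intro integrable_norm i2)
            show "integrable lborel (\<lambda>t. ((cmod (\<phi> t))\<^sup>2 + (cmod (\<phi> (t + (- x - \<delta> * r))))\<^sup>2) / 2)"
              using integrable_lborel_translate[OF L2, of "- x - \<delta> * r"] L2 by simp
            show "cmod (\<phi> t * cnj (\<phi> (t - x - \<delta> * r)))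
                \<le> ((cmod (\<phi> t))\<^sup>2 + (cmod (\<phi> (t + (- x - \<delta> * r))))\<^sup>2) / 2" for t
              using mult_le_weighted_squares[of 1 "cmod (\<phi> t)" "cmod (\<phi> (t - x - \<delta> * r))"]
              by (simp add: norm_mult add_diff_eq)
          qed
          also have "\<dots> = (K + (LINT t|lborel. (cmod (\<phi> (t + (- x - \<delta> * r))))\<^sup>2)) / 2"
            using integrable_lborel_translate[OF L2, of "- x - \<delta> * r"] L2 by (simp add: K_def)
          also have "(LINT t|lborel. (cmod (\<phi> (t + (- x - \<delta> * r))))\<^sup>2) = K"
            unfolding K_def
            by (rule integral_lborel_translate[where f = "\<lambda>t. (cmod (\<phi> t))\<^sup>2"]) measurable
          finally have le: "(LINT t|lborel. cmod (\<phi> t * cnj (\<phi> (t - x - \<delta> * r)))) \<le> K" by simp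
          have "(LINT t|lborel. cmod (\<phi> t * cnj (\<phi> (t - x - \<delta> * r)))) \<ge> 0"
            by (intro integral_nonneg_AE) auto
          then show "norm (LINT t|lborel. cmod (case (r, t) of (r, t) \<Rightarrow> \<phi> t * cnj (\<phi> (t - x - \<delta> * r)) * gauss 1 r))
              \<le> norm (K * cmod (gauss 1 r))"
            using le by (simp add: norm_mult[of _ "gauss 1 r"] abs_mult mult_right_mono)
        qed
      qed measurable
    qed measurable
  qed
  also have "\<dots> = (LINT r|lborel. gauss 1 r * autocorr \<phi> (x + \<delta> * r))"
  proof (intro Bochner_Integration.integral_cong refl)
    fix r
    have "(LINT t|lborel. \<phi> t * cnj (\<phi> (t - x - \<delta> * r)) * gauss 1 r)
        = (LINT t|lborel. \<phi> t * cnj (\<phi> (t - (x + \<delta> * r)))) * gauss 1 r"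
      by (simp add: diff_diff_eq)
    also have "(LINT t|lborel. \<phi> t * cnj (\<phi> (t - (x + \<delta> * r))))
        = (LINT t|lborel. \<phi> (t + (x + \<delta> * r)) * cnj (\<phi> (t + (x + \<delta> * r) - (x + \<delta> * r))))"
      by (rule integral_lborel_translate[where f = "\<lambda>t. \<phi> t * cnj (\<phi> (t - (x + \<delta> * r)))", symmetric]) measurable
    finally show "(LINT t|lborel. \<phi> t * cnj (\<phi> (t - x - \<delta> * r)) * gauss 1 r)
        = gauss 1 r * autocorr \<phi> (x + \<delta> * r)"
      by (simp add: autocorr_def mult.commute)
  qed
  finally show ?thesis .
qed

lemma regularised_limit:
  "(\<lambda>n. LINT r|lborel. gauss 1 r * autocorr \<phi> (x + inverse (real (Suc n)) * r)) \<longlonglongrightarrow> autocorr \<phi> x"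
proof -
  define K where "K = (LINT t|lborel. (cmod (\<phi> t))\<^sup>2)"
  have "(\<lambda>n. LINT r|lborel. gauss 1 r * autocorr \<phi> (x + inverse (real (Suc n)) * r))
      \<longlonglongrightarrow> (LINT r|lborel. gauss 1 r * autocorr \<phi> x)"
  proof (rule integral_dominated_convergence)
    show "integrable lborel (\<lambda>r. cmod (gauss 1 r) * K)"
      using integrable_gauss[of 1] by auto
    show "AE r in lborel. (\<lambda>n. gauss 1 r * autocorr \<phi> (x + inverse (real (Suc n)) * r))
        \<longlonglongrightarrow> gauss 1 r * autocorr \<phi> x"
    proof (rule AE_I2)
      fix r
      have "(\<lambda>n. x + inverse (real (Suc n)) * r) \<longlonglongrightarrow> x + 0 * r"
        by (intro tendsto_intros LIMSEQ_inverse_real_of_nat)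
      then show "(\<lambda>n. gauss 1 r * autocorr \<phi> (x + inverse (real (Suc n)) * r))
          \<longlonglongrightarrow> gauss 1 r * autocorr \<phi> x"
        by (intro tendsto_intros isCont_tendsto_compose[OF isCont_autocorr]) simp
    qed
    show "AE r in lborel. cmod (gauss 1 r * autocorr \<phi> (x + inverse (real (Suc n)) * r)) \<le> cmod (gauss 1 r) * K" for n
      using norm_autocorr_le by (intro AE_I2) (simp add: norm_mult K_def mult_left_mono)
  qed measurable
  then show ?thesis by (simp add: integral_gauss_1)
qed

text \<open>Monotone convergence of the regularised integrals at \<open>x = 0\<close>, where the integrand is nonnegative.\<close>

theorem integrable_fourier1_L2: "integrable lborel (\<lambda>\<omega>. (cmod (fourier1 \<phi> \<omega>))\<^sup>2)"
proof -
  define K where "K = (LINT t|lborel. (cmod (\<phi> t))\<^sup>2)"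
  define G where "G n \<omega> = (cmod (fourier1 \<phi> \<omega>))\<^sup>2 * exp (- pi * (inverse (real (Suc n)) * \<omega>)\<^sup>2)" for n \<omega>
  have G: "complex_of_real (G n \<omega>) = complex_of_real ((cmod (fourier1 \<phi> \<omega>))\<^sup>2) * cis (2 * pi * \<omega> * 0)
      * gauss (inverse (real (Suc n))) \<omega>" for n \<omega>
    by (simp add: G_def gauss_def)
  define B where "B = (LINT t|lborel. cmod (\<phi> t))"
  have intG: "integrable lborel (G n)" for n
  proof (rule Bochner_Integration.integrable_bound)
    show "integrable lborel (\<lambda>\<omega>. B\<^sup>2 * cmod (gauss (inverse (real (Suc n))) \<omega>))"
      using integrable_gauss[of "inverse (real (Suc n))"] by auto
    show "AE \<omega> in lborel. norm (G n \<omega>) \<le> norm (B\<^sup>2 * cmod (gauss (inverse (real (Suc n))) \<omega>))"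
      using norm_fourier1_le[OF L1]
      by (intro AE_I2) (auto simp: G_def gauss_def B_def abs_mult intro!: mult_right_mono power_mono)
    show "G n \<in> borel_measurable lborel" unfolding G_def by measurable
  qed
  have lim: "(\<lambda>n. LINT \<omega>|lborel. G n \<omega>) \<longlonglongrightarrow> Re (autocorr \<phi> 0)"
  proof -
    have "complex_of_real (LINT \<omega>|lborel. G n \<omega>)
        = (LINT r|lborel. gauss 1 r * autocorr \<phi> (0 + inverse (real (Suc n)) * r))" for n
      unfolding integral_complex_of_real[symmetric] G
      by (rule regularised_plancherel) simp
    then have "(\<lambda>n. complex_of_real (LINT \<omega>|lborel. G n \<omega>)) \<longlonglongrightarrow> autocorr \<phi> 0"
      using regularised_limit[of 0] by simp
    from tendsto_Re[OF this] show ?thesis by simp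
  qed
  show ?thesis
  proof (rule integrable_monotone_convergence[OF intG _ _ lim])
    show "AE \<omega> in lborel. mono (\<lambda>n. G n \<omega>)"
    proof (intro AE_I2 monoI)
      fix \<omega> and i j :: nat assume "i \<le> j"
      then have "(inverse (real (Suc j)) * \<omega>)\<^sup>2 \<le> (inverse (real (Suc i)) * \<omega>)\<^sup>2"
        unfolding power_mult_distrib by (intro mult_right_mono power_mono le_imp_inverse_le) auto
      then show "G i \<omega> \<le> G j \<omega>"
        unfolding G_def by (intro mult_left_mono) auto
    qed
    show "AE \<omega> in lborel. (\<lambda>n. G n \<omega>) \<longlonglongrightarrow> (cmod (fourier1 \<phi> \<omega>))\<^sup>2"
    proof (rule AE_I2)
      fix \<omega>
      have "(\<lambda>n. G n \<omega>) \<longlonglongrightarrow> (cmod (fourier1 \<phi> \<omega>))\<^sup>2 * exp (- pi * (0 * \<omega>)\<^sup>2)"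
        unfolding G_def by (intro tendsto_intros LIMSEQ_inverse_real_of_nat)
      then show "(\<lambda>n. G n \<omega>) \<longlonglongrightarrow> (cmod (fourier1 \<phi> \<omega>))\<^sup>2" by simp
    qed
  qed measurable
qed

theorem plancherel_autocorr:
  "(LINT \<omega>|lborel. complex_of_real ((cmod (fourier1 \<phi> \<omega>))\<^sup>2) * cis (2 * pi * \<omega> * x)) = autocorr \<phi> x"
proof (rule LIMSEQ_unique)
  show "(\<lambda>n. LINT \<omega>|lborel. complex_of_real ((cmod (fourier1 \<phi> \<omega>))\<^sup>2) * cis (2 * pi * \<omega> * x)
        * gauss (inverse (real (Suc n))) \<omega>)
      \<longlonglongrightarrow> (LINT \<omega>|lborel. complex_of_real ((cmod (fourier1 \<phi> \<omega>))\<^sup>2) * cis (2 * pi * \<omega> * x))"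
  proof (rule integral_dominated_convergence[OF _ _ integrable_fourier1_L2])
    show "AE \<omega> in lborel. (\<lambda>n. complex_of_real ((cmod (fourier1 \<phi> \<omega>))\<^sup>2) * cis (2 * pi * \<omega> * x)
        * gauss (inverse (real (Suc n))) \<omega>) \<longlonglongrightarrow> complex_of_real ((cmod (fourier1 \<phi> \<omega>))\<^sup>2) * cis (2 * pi * \<omega> * x)"
      using tendsto_mult[OF tendsto_const gauss_tendsto_1] by (intro AE_I2) simp
    show "AE \<omega> in lborel. cmod (complex_of_real ((cmod (fourier1 \<phi> \<omega>))\<^sup>2) * cis (2 * pi * \<omega> * x)
        * gauss (inverse (real (Suc n))) \<omega>) \<le> (cmod (fourier1 \<phi> \<omega>))\<^sup>2" for n
      by (intro AE_I2) (simp add: norm_mult gauss_def mult_left_le del: of_real_power)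
  qed measurable
  show "(\<lambda>n. LINT \<omega>|lborel. complex_of_real ((cmod (fourier1 \<phi> \<omega>))\<^sup>2) * cis (2 * pi * \<omega> * x)
        * gauss (inverse (real (Suc n))) \<omega>) \<longlonglongrightarrow> autocorr \<phi> x"
    using regularised_limit by (subst regularised_plancherel) auto
qed

end

section \<open>Borel representatives\<close>

text \<open>Fubini's theorem is available for the product of Borel measures, whereas signals and noise are Lebesgue measurable.\<close>

lemma borel_representative:
  fixes f :: "'a::euclidean_space \<Rightarrow> complex"
  assumes [measurable]: "f \<in> borel_measurable lebesgue"
  obtains f' where "f' \<in> borel_measurable borel" "AE x in lborel. f x = f' x"
proof -
  obtain r where r: "r \<in> borel_measurable lborel" "AE x in lborel. Re (f x) = r x"
    using completion_ex_borel_measurable_real[of "\<lambda>x. Re (f x)" lborel] by auto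
  obtain i where i: "i \<in> borel_measurable lborel" "AE x in lborel. Im (f x) = i x"
    using completion_ex_borel_measurable_real[of "\<lambda>x. Im (f x)" lborel] by auto
  show thesis
  proof
    show "(\<lambda>x. Complex (r x) (i x)) \<in> borel_measurable borel"
      using r(1) i(1) by (simp add: complex_eq borel_measurable_complex_iff)
    show "AE x in lborel. f x = Complex (r x) (i x)"
      using r(2) i(2) by eventually_elim (simp add: complex_eq_iff)
  qed
qed

lemma
  fixes F :: "'a::euclidean_space \<Rightarrow> 'b::euclidean_space"
  assumes F': "F' \<in> borel_measurable borel" and ae: "AE x in lborel. F x = F' x"
  shows measurable_lebesgue_representative: "F \<in> borel_measurable lebesgue"
    and integrable_lebesgue_representative: "integrable lebesgue F \<longleftrightarrow> integrable lborel F'"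
    and integral_lebesgue_representative: "(LINT x|lebesgue. F x) = (LINT x|lborel. F' x)"
proof -
  have F'l: "F' \<in> borel_measurable lebesgue" using F' by (simp add: measurable_completion)
  have ael: "AE x in lebesgue. F x = F' x" using ae by (rule AE_completion)
  then have "AE x in lebesgue. F' x = F x" by eventually_elim simp
  then show Fl: "F \<in> borel_measurable lebesgue" by (rule borel_measurable_AE[OF F'l])
  show "integrable lebesgue F \<longleftrightarrow> integrable lborel F'"
    using integrable_cong_AE[OF Fl F'l ael] F' by (simp add: integrable_completion)
  show "(LINT x|lebesgue. F x) = (LINT x|lborel. F' x)"
    using integral_cong_AE[OF Fl F'l ael] F' by (simp add: integral_completion)
qed

lemma AE_lborel_translate:
  fixes P :: "real \<Rightarrow> bool"
  assumes "AE t in lborel. P t"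
  shows "AE t in lborel. P (t + a)"
proof -
  obtain N where N: "N \<in> null_sets lborel" "{t. \<not> P t} \<subseteq> N"
    using assms by (auto elim!: AE_E simp: null_sets_def)
  have "AE t in lborel. t \<notin> N" using N(1) by (rule AE_not_in)
  then have "AE t in lborel. a + 1 * t \<notin> N"
    using N(1) by (intro AE_borel_affine[where P = "\<lambda>t. t \<notin> N"]) (auto simp: null_sets_def)
  then show ?thesis by eventually_elim (use N(2) in \<open>auto simp: add.commute\<close>)
qed

lemma square_integrable_representative:
  assumes "square_integrable f"
  obtains f' where "f' \<in> borel_measurable borel" "AE t in lborel. f t = f' t"
    "integrable lborel (\<lambda>t. (cmod (f' t))\<^sup>2)"
proof -
  obtain f' where f': "f' \<in> borel_measurable borel" "AE t in lborel. f t = f' t"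
    using assms unfolding square_integrable_def by (metis borel_representative)
  have "integrable lebesgue (\<lambda>t. (cmod (f t))\<^sup>2) \<longleftrightarrow> integrable lborel (\<lambda>t. (cmod (f' t))\<^sup>2)"
  proof (rule integrable_lebesgue_representative)
    show "AE t in lborel. (cmod (f t))\<^sup>2 = (cmod (f' t))\<^sup>2"
      using f'(2) by eventually_elim simp
  qed (use f'(1) in measurable)
  then show thesis using that f' assms by (simp add: square_integrable_def)
qed

section \<open>The orthogonality relation\<close>

text \<open>The localised signal whose Fourier transform is the short-time Fourier transform at position \<open>x\<close>.\<close>

definition windowed :: "(real \<Rightarrow> complex) \<Rightarrow> (real \<Rightarrow> complex) \<Rightarrow> real \<Rightarrow> real \<Rightarrow> complex" where
  "windowed f g x t = f t * cnj (g (t - x))"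

lemma STFT_representative:
  assumes [measurable]: "f' \<in> borel_measurable borel" "g' \<in> borel_measurable borel"
    and f: "AE t in lborel. f t = f' t" and g: "AE t in lborel. g t = g' t"
  shows "STFT g f (x, y) = fourier1 (windowed f' g' x) y"
  unfolding STFT_def fourier1_def windowed_def prod.case
proof (rule integral_lebesgue_representative)
  show "AE t in lborel. f t * cnj (g (t - x)) * cis (- 2 * pi * t * y)
      = f' t * cnj (g' (t - x)) * cis (- 2 * pi * t * y)"
    using f AE_lborel_translate[OF g, of "- x"] by eventually_elim simp
qed measurable

lemma ambiguity_representative:
  assumes [measurable]: "f' \<in> borel_measurable borel" and f: "AE t in lborel. f t = f' t"
  shows "ambiguity f (x, y)
    = (LINT t|lborel. f' (t + x / 2) * cnj (f' (t - x / 2)) * cis (- 2 * pi * t * y))"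
  unfolding ambiguity_def prod.case
proof (rule integral_lebesgue_representative)
  show "AE t in lborel. f (t + x / 2) * cnj (f (t - x / 2)) * cis (- 2 * pi * t * y)
      = f' (t + x / 2) * cnj (f' (t - x / 2)) * cis (- 2 * pi * t * y)"
    using AE_lborel_translate[OF f, of "x / 2"] AE_lborel_translate[OF f, of "- (x / 2)"]
    by eventually_elim simp
qed measurable

lemma borel_measurable_ambiguity [measurable]:
  assumes "square_integrable f"
  shows "ambiguity f \<in> borel_measurable borel"
proof -
  obtain f' where [measurable]: "f' \<in> borel_measurable borel" and f': "AE t in lborel. f t = f' t"
    using square_integrable_representative[OF assms] by metis
  have "ambiguity f = (\<lambda>(x, y). LINT t|lborel. f' (t + x / 2) * cnj (f' (t - x / 2)) * cis (- 2 * pi * t * y))"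
    using ambiguity_representative[OF _ f'] by auto
  moreover have "(\<lambda>(x, y). LINT t|lborel. f' (t + x / 2) * cnj (f' (t - x / 2)) * cis (- 2 * pi * t * y))
      \<in> borel_measurable (borel \<Otimes>\<^sub>M borel)"
    by measurable
  ultimately show ?thesis by (simp add: borel_prod)
qed

lemma ambiguity_bounded:
  assumes "square_integrable f"
  obtains B where "0 \<le> B" "\<And>z. cmod (ambiguity f z) \<le> B"
proof -
  obtain f' where [measurable]: "f' \<in> borel_measurable borel" and f': "AE t in lborel. f t = f' t"
    and L2: "integrable lborel (\<lambda>t. (cmod (f' t))\<^sup>2)"
    using square_integrable_representative[OF assms] by metis
  define B where "B = (LINT t|lborel. (cmod (f' t))\<^sup>2)"
  have sh: "integrable lborel (\<lambda>t. (cmod (f' (t + a)))\<^sup>2)" "(LINT t|lborel. (cmod (f' (t + a)))\<^sup>2) = B" for a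
    using integrable_lborel_translate[OF L2] integral_lborel_translate[of "\<lambda>t. (cmod (f' t))\<^sup>2" a]
    by (auto simp: B_def)
  show thesis
  proof
    show "0 \<le> B" unfolding B_def by (intro integral_nonneg_AE) auto
    fix z :: "real \<times> real"
    obtain x y where z: "z = (x, y)" by force
    have sh': "integrable lborel (\<lambda>t. (cmod (f' (t - x / 2)))\<^sup>2)" "(LINT t|lborel. (cmod (f' (t - x / 2)))\<^sup>2) = B"
      using sh[of "- (x / 2)"] by simp_all
    have "cmod (ambiguity f z) = cmod (LINT t|lborel. f' (t + x / 2) * (cnj (f' (t - x / 2)) * cis (- 2 * pi * t * y)))"
      unfolding z by (subst ambiguity_representative[OF _ f']) (auto simp: mult.assoc)
    also have "\<dots> \<le> (1 * (LINT t|lborel. (cmod (f' (t + x / 2)))\<^sup>2)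
        + (LINT t|lborel. (cmod (cnj (f' (t - x / 2)) * cis (- 2 * pi * t * y)))\<^sup>2) / 1) / 2"
      by (rule norm_integral_mult_L2_le) (use sh sh' in \<open>auto simp: norm_mult\<close>)
    also have "\<dots> = B" using sh sh' by (simp add: norm_mult)
    finally show "cmod (ambiguity f z) \<le> B" .
  qed
qed

text \<open>The ambiguity function before the symmetric shift by \<open>x / 2\<close>. It is what the autocorrelation of a localised
signal produces; the two versions differ by a unimodular factor, which cancels in the orthogonality relation.\<close>

definition ambiguity_unsym :: "(real \<Rightarrow> complex) \<Rightarrow> real \<Rightarrow> real \<Rightarrow> complex" where
  "ambiguity_unsym f x y = (LINT t|lborel. f (t + x) * cnj (f t) * cis (- 2 * pi * t * y))"

text \<open>The shear \<open>(s, t) \<mapsto> (t - s, t)\<close> preserves Lebesgue measure.\<close>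

lemma integrable_shear:
  fixes a b :: "real \<Rightarrow> complex"
  assumes a: "integrable lborel a" and b: "integrable lborel b"
  shows "integrable (lborel \<Otimes>\<^sub>M lborel) (\<lambda>(s, t). a t * b (t - s))"
proof -
  have [measurable]: "a \<in> borel_measurable borel" "b \<in> borel_measurable borel"
    using a b by (auto dest: borel_measurable_integrable)
  have bs: "integrable lborel (\<lambda>s. b (t - s))" for t
    using lborel_integrable_real_affine[OF b, of "-1" t] by simp
  have ibs: "(LINT s|lborel. cmod (b (t - s))) = (LINT r|lborel. cmod (b r))" for t
    using lborel_integral_real_affine[of "-1" "\<lambda>r. cmod (b r)" t] by simp
  have "integrable (lborel \<Otimes>\<^sub>M lborel) (\<lambda>(t, s). a t * b (t - s))"
  proof (rule lborel_pair.Fubini_integrable)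
    show "AE t in lborel. integrable lborel (\<lambda>s. case (t, s) of (t, s) \<Rightarrow> a t * b (t - s))"
      using bs by simp
    show "integrable lborel (\<lambda>t. LINT s|lborel. cmod (case (t, s) of (t, s) \<Rightarrow> a t * b (t - s)))"
      using a by (simp add: norm_mult ibs)
  qed measurable
  from lborel_pair.integrable_product_swap[OF this] show ?thesis
    by (simp add: case_prod_beta')
qed

context
  fixes f g :: "real \<Rightarrow> complex"
  assumes meas_fg [measurable]: "f \<in> borel_measurable borel" "g \<in> borel_measurable borel"
    and f2: "integrable lborel (\<lambda>t. (cmod (f t))\<^sup>2)" and g2: "integrable lborel (\<lambda>t. (cmod (g t))\<^sup>2)"
begin

lemma integrable_windowed: "integrable lborel (windowed f g s)"
proof -
  have "integrable lborel (\<lambda>t. (cmod (cnj (g (t + - s))))\<^sup>2)"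
    using integrable_lborel_translate[OF g2, of "- s"] by simp
  then show ?thesis
    unfolding windowed_def by (intro integrable_mult_L2) (auto simp: f2)
qed

lemma integrable_windowed_L2_pair:
  "integrable (lborel \<Otimes>\<^sub>M lborel) (\<lambda>(s, t). (cmod (windowed f g s t))\<^sup>2)"
proof -
  have "integrable (lborel \<Otimes>\<^sub>M lborel) (\<lambda>z. cmod ((\<lambda>(s, t). complex_of_real ((cmod (f t))\<^sup>2) * complex_of_real ((cmod (g (t - s)))\<^sup>2)) z))"
    by (intro integrable_norm integrable_shear integrable_of_real f2 g2)
  then show ?thesis
    by (simp add: case_prod_beta' windowed_def norm_mult power_mult_distrib norm_power)
qed

text \<open>A product of two square integrable functions need not be square integrable, but
\<open>\<integral>\<integral> \<bar>f t\<bar>\<^sup>2 \<bar>g (t - s)\<bar>\<^sup>2\<close> is finite, which makes the inner integral finite for almost all shifts.\<close>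

lemma AE_windowed_L2:
  "AE s in lborel. integrable lborel (\<lambda>t. (cmod (windowed f g s t))\<^sup>2)"
  using lborel_pair.AE_integrable_fst[OF integrable_windowed_L2_pair] .

lemma borel_measurable_windowed [measurable]:
  "(\<lambda>(s, t). windowed f g s t) \<in> borel_measurable (borel \<Otimes>\<^sub>M borel)"
  unfolding windowed_def by measurable

lemma borel_measurable_STFT_pair [measurable]:
  "(\<lambda>(s, \<omega>). fourier1 (windowed f g s) \<omega>) \<in> borel_measurable (borel \<Otimes>\<^sub>M borel)"
  unfolding fourier1_def windowed_def by measurable

lemma integrable_spectrogram_borel:
  "integrable (lborel \<Otimes>\<^sub>M lborel) (\<lambda>(s, \<omega>). (cmod (fourier1 (windowed f g s) \<omega>))\<^sup>2)"
proof (rule lborel_pair.Fubini_integrable)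
  show "AE s in lborel. integrable lborel (\<lambda>\<omega>. case (s, \<omega>) of (s, \<omega>) \<Rightarrow> (cmod (fourier1 (windowed f g s) \<omega>))\<^sup>2)"
    using AE_windowed_L2
    by eventually_elim (simp add: integrable_fourier1_L2 integrable_windowed)
  have "integrable lborel (\<lambda>s. LINT t|lborel. (cmod (windowed f g s t))\<^sup>2)"
    using lborel_pair.integrable_fst[OF integrable_windowed_L2_pair] .
  moreover have "AE s in lborel. (LINT t|lborel. (cmod (windowed f g s t))\<^sup>2)
      = (LINT \<omega>|lborel. norm (case (s, \<omega>) of (s, \<omega>) \<Rightarrow> (cmod (fourier1 (windowed f g s) \<omega>))\<^sup>2))"
    using AE_windowed_L2
  proof eventually_elim
    case (elim s)
    have "complex_of_real (LINT \<omega>|lborel. (cmod (fourier1 (windowed f g s) \<omega>))\<^sup>2)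
        = autocorr (windowed f g s) 0"
      using plancherel_autocorr[OF integrable_windowed elim, of 0]
      by (simp add: integral_complex_of_real del: of_real_power)
    also have "\<dots> = complex_of_real (LINT t|lborel. (cmod (windowed f g s t))\<^sup>2)"
      by (simp add: autocorr_def complex_norm_square[symmetric] integral_complex_of_real del: of_real_power)
    finally show ?case by simp
  qed
  ultimately show "integrable lborel (\<lambda>s. LINT \<omega>|lborel. norm (case (s, \<omega>) of (s, \<omega>) \<Rightarrow> (cmod (fourier1 (windowed f g s) \<omega>))\<^sup>2))"
    by (subst integrable_cong_AE[rotated 2]) auto
qed measurable

text \<open>Plancherel's formula evaluates the integral over frequencies for almost every \<open>s\<close>. Exchanging the two remaining integrals
and substituting \<open>r = t - s\<close> separates the variables.\<close>

lemma fourier_spectrogram_borel: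
  "(LINT z|(lborel \<Otimes>\<^sub>M lborel). complex_of_real ((cmod (fourier1 (windowed f g (fst z)) (snd z)))\<^sup>2)
      * cis (- 2 * pi * (fst z * y - snd z * x)))
    = ambiguity_unsym f x y * cnj (ambiguity_unsym g x y)"
proof -
  have "integrable (lborel \<Otimes>\<^sub>M lborel) (\<lambda>z. complex_of_real ((cmod (fourier1 (windowed f g (fst z)) (snd z)))\<^sup>2)
      * cis (- 2 * pi * (fst z * y - snd z * x)))"
    using integrable_spectrogram_borel
    by (intro integrable_cis_mult integrable_of_real) (auto simp: case_prod_beta')
  then have "(LINT z|(lborel \<Otimes>\<^sub>M lborel). complex_of_real ((cmod (fourier1 (windowed f g (fst z)) (snd z)))\<^sup>2)
      * cis (- 2 * pi * (fst z * y - snd z * x)))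
    = (LINT s|lborel. LINT \<omega>|lborel. complex_of_real ((cmod (fourier1 (windowed f g s) \<omega>))\<^sup>2)
      * cis (- 2 * pi * (s * y - \<omega> * x)))"
    by (subst lborel_pair.integral_fst'[symmetric]) auto
  also have "\<dots> = (LINT s|lborel. autocorr (windowed f g s) x * cis (- 2 * pi * s * y))"
  proof (rule integral_cong_AE)
    show "AE s in lborel. (LINT \<omega>|lborel. complex_of_real ((cmod (fourier1 (windowed f g s) \<omega>))\<^sup>2)
      * cis (- 2 * pi * (s * y - \<omega> * x))) = autocorr (windowed f g s) x * cis (- 2 * pi * s * y)"
      using AE_windowed_L2
    proof eventually_elim
      case (elim s)
      have "cis (- 2 * pi * (s * y - \<omega> * x)) = cis (2 * pi * \<omega> * x) * cis (- 2 * pi * s * y)" for \<omega>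
        by (simp add: cis_mult algebra_simps)
      then have "(LINT \<omega>|lborel. complex_of_real ((cmod (fourier1 (windowed f g s) \<omega>))\<^sup>2)
          * cis (- 2 * pi * (s * y - \<omega> * x)))
        = (LINT \<omega>|lborel. complex_of_real ((cmod (fourier1 (windowed f g s) \<omega>))\<^sup>2)
          * cis (2 * pi * \<omega> * x) * cis (- 2 * pi * s * y))"
        by (simp only: mult.assoc)
      then show ?case
        by (simp only: integral_mult_left_zero plancherel_autocorr[OF integrable_windowed elim])
    qed
    show "(\<lambda>s. autocorr (windowed f g s) x * cis (- 2 * pi * s * y)) \<in> borel_measurable lborel"
      unfolding autocorr_def by measurable
  qed measurable
  also have "\<dots> = (LINT s|lborel. LINT t|lborel.
      (f (t + x) * cnj (f t)) * (cnj (g (t - s + x)) * g (t - s)) * cis (- 2 * pi * s * y))"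
    unfolding autocorr_def integral_mult_left_zero[symmetric]
    by (intro Bochner_Integration.integral_cong refl) (simp add: windowed_def algebra_simps)
  also have "\<dots> = (LINT t|lborel. LINT s|lborel.
      (f (t + x) * cnj (f t)) * (cnj (g (t - s + x)) * g (t - s)) * cis (- 2 * pi * s * y))"
  proof (rule lborel_pair.Fubini_integral[symmetric])
    have "integrable lborel (\<lambda>t. f (t + x) * cnj (f t))"
      by (intro integrable_mult_L2) (auto intro: integrable_lborel_translate[OF f2] f2)
    moreover have "integrable lborel (\<lambda>t. cnj (g (t + x)) * g t)"
      by (intro integrable_mult_L2) (auto intro: integrable_lborel_translate[OF g2] g2)
    ultimately have "integrable (lborel \<Otimes>\<^sub>M lborel)
        (\<lambda>(s, t). (f (t + x) * cnj (f t)) * (cnj (g (t - s + x)) * g (t - s)))"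
      by (rule integrable_shear)
    from integrable_cis_mult[OF this, of "\<lambda>z. - 2 * pi * fst z * y"]
    show "integrable (lborel \<Otimes>\<^sub>M lborel)
        (\<lambda>(s, t). (f (t + x) * cnj (f t)) * (cnj (g (t - s + x)) * g (t - s)) * cis (- 2 * pi * s * y))"
      by (simp add: case_prod_beta')
  qed
  also have "\<dots> = (LINT t|lborel. f (t + x) * cnj (f t) * cis (- 2 * pi * t * y) * cnj (ambiguity_unsym g x y))"
  proof (intro Bochner_Integration.integral_cong refl)
    fix t
    have "(LINT s|lborel. (f (t + x) * cnj (f t)) * (cnj (g (t - s + x)) * g (t - s)) * cis (- 2 * pi * s * y))
      = \<bar>-1\<bar> *\<^sub>R (LINT r|lborel. (f (t + x) * cnj (f t)) * (cnj (g (t - (t + -1 * r) + x)) * g (t - (t + -1 * r)))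
          * cis (- 2 * pi * (t + -1 * r) * y))"
      by (rule lborel_integral_real_affine) simp
    also have "\<dots> = (LINT r|lborel. (f (t + x) * cnj (f t) * cis (- 2 * pi * t * y))
        * cnj (g (r + x) * cnj (g r) * cis (- 2 * pi * r * y)))"
    proof -
      have "cis (- 2 * pi * (t + -1 * r) * y) = cis (- 2 * pi * t * y) * cnj (cis (- 2 * pi * r * y))" for r
        by (simp add: cis_cnj cis_mult algebra_simps)
      then show ?thesis by (simp add: mult_ac)
    qed
    also have "\<dots> = f (t + x) * cnj (f t) * cis (- 2 * pi * t * y) * cnj (ambiguity_unsym g x y)"
      unfolding ambiguity_unsym_def by (simp only: integral_mult_right_zero Bochner_Integration.integral_cnj)
    finally show "(LINT s|lborel. (f (t + x) * cnj (f t)) * (cnj (g (t - s + x)) * g (t - s)) * cis (- 2 * pi * s * y))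
        = f (t + x) * cnj (f t) * cis (- 2 * pi * t * y) * cnj (ambiguity_unsym g x y)" .
  qed
  also have "\<dots> = ambiguity_unsym f x y * cnj (ambiguity_unsym g x y)"
    unfolding ambiguity_unsym_def[of f] by (simp only: integral_mult_left_zero)
  finally show ?thesis .
qed

end

lemma ambiguity_unsym_eq:
  assumes [measurable]: "f' \<in> borel_measurable borel" and f: "AE t in lborel. f t = f' t"
  shows "ambiguity_unsym f' x y = cis (pi * x * y) * ambiguity f (x, y)"
proof -
  have "ambiguity f (x, y) = (LINT t|lborel. f' (t + x / 2 + x / 2) * cnj (f' (t + x / 2 - x / 2)) * cis (- 2 * pi * (t + x / 2) * y))"
    unfolding ambiguity_representative[OF assms]
    by (rule integral_lborel_translate[where f = "\<lambda>t. f' (t + x / 2) * cnj (f' (t - x / 2)) * cis (- 2 * pi * t * y)", symmetric])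
      measurable
  also have "\<dots> = (LINT t|lborel. cis (- (pi * x * y)) * (f' (t + x) * cnj (f' t) * cis (- 2 * pi * t * y)))"
  proof -
    have "cis (- 2 * pi * (t + x / 2) * y) = cis (- (pi * x * y)) * cis (- 2 * pi * t * y)" for t
      by (simp add: cis_mult algebra_simps)
    moreover have "f' (t + x / 2 + x / 2) = f' (t + x)" for t by (simp add: add.assoc)
    ultimately show ?thesis by (simp only: add_diff_cancel_right' mult_ac)
  qed
  also have "\<dots> = cis (- (pi * x * y)) * ambiguity_unsym f' x y"
    unfolding ambiguity_unsym_def by (simp only: integral_mult_right_zero)
  finally show ?thesis by (simp add: cis_mult flip: mult.assoc)
qed

theorem
  assumes "square_integrable f" "square_integrable g"
  shows integrable_spectrogram: "integrable lebesgue (\<lambda>z. complex_of_real ((cmod (STFT g f z))\<^sup>2))"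
    and fourier2_spectrogram: "fourier2 (\<lambda>z. complex_of_real ((cmod (STFT g f z))\<^sup>2)) (y, - x)
      = ambiguity f (x, y) * cnj (ambiguity g (x, y))"
proof -
  obtain f' where f' [measurable]: "f' \<in> borel_measurable borel" and fae: "AE t in lborel. f t = f' t"
    and f2: "integrable lborel (\<lambda>t. (cmod (f' t))\<^sup>2)"
    using square_integrable_representative[OF assms(1)] by metis
  obtain g' where g' [measurable]: "g' \<in> borel_measurable borel" and gae: "AE t in lborel. g t = g' t"
    and g2: "integrable lborel (\<lambda>t. (cmod (g' t))\<^sup>2)"
    using square_integrable_representative[OF assms(2)] by metis
  define S where "S z = complex_of_real ((cmod (fourier1 (windowed f' g' (fst z)) (snd z)))\<^sup>2)" for z
  have S: "(\<lambda>z. complex_of_real ((cmod (STFT g f z))\<^sup>2)) = S"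
    using STFT_representative[OF f' g' fae gae] by (auto simp: S_def)
  have "integrable (lborel \<Otimes>\<^sub>M lborel) S"
    using integrable_spectrogram_borel[OF f' g' f2 g2]
    unfolding S_def by (intro integrable_of_real) (simp add: case_prod_beta')
  then have int: "integrable lborel S" by (simp add: lborel_prod)
  then have [measurable]: "S \<in> borel_measurable borel" by (auto dest: borel_measurable_integrable)
  show "integrable lebesgue (\<lambda>z. complex_of_real ((cmod (STFT g f z))\<^sup>2))"
    unfolding S using int by (simp add: integrable_completion)
  have "fourier2 S (y, - x) = (LINT z|lborel. S z * cis (- 2 * pi * (z \<bullet> (y, - x))))"
    unfolding fourier2_def by (rule integral_completion) measurable
  also have "\<dots> = (LINT z|(lborel \<Otimes>\<^sub>M lborel). S z * cis (- 2 * pi * (fst z * y - snd z * x)))"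
    by (simp add: lborel_prod inner_prod_def)
  also have "\<dots> = ambiguity_unsym f' x y * cnj (ambiguity_unsym g' x y)"
    unfolding S_def by (rule fourier_spectrogram_borel[OF f' g' f2 g2])
  also have "\<dots> = ambiguity f (x, y) * cnj (ambiguity g (x, y))"
  proof -
    have "cis (pi * x * y) * cnj (cis (pi * x * y)) = 1"
      by (simp add: cis_cnj cis_mult)
    then show ?thesis
      unfolding ambiguity_unsym_eq[OF f' fae] ambiguity_unsym_eq[OF g' gae]
      by (simp add: mult_ac)
  qed
  finally show "fourier2 (\<lambda>z. complex_of_real ((cmod (STFT g f z))\<^sup>2)) (y, - x)
      = ambiguity f (x, y) * cnj (ambiguity g (x, y))"
    unfolding S .
qed

section \<open>Decay of the ambiguity function\<close>

text \<open>Translating by half a period of the exponential, \<open>\<xi> / (2 \<bar>\<xi>\<bar>\<^sup>2)\<close>, changes its sign. The transform is therefore bounded by half the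
\<open>L\<^sup>1\<close> distance of \<open>F\<close> from this translate, which becomes short as \<open>\<xi>\<close> grows.\<close>

lemma riemann_lebesgue:
  fixes F :: "'a::euclidean_space \<Rightarrow> complex"
  assumes F: "integrable lborel F" and "e > 0"
  obtains R where "\<And>\<xi>. R < norm \<xi> \<Longrightarrow> cmod (LINT z|lborel. F z * cis (- 2 * pi * (z \<bullet> \<xi>))) < e"
proof -
  have [measurable]: "F \<in> borel_measurable borel" using F by (auto dest: borel_measurable_integrable)
  have "eventually (\<lambda>r. translation_modulus F r < e) (at 0)"
    using translation_modulus_tendsto_0[OF F] \<open>e > 0\<close> by (rule order_tendstoD(2))
  then obtain d where "d > 0" and d: "\<And>r. r \<noteq> 0 \<Longrightarrow> norm r < d \<Longrightarrow> translation_modulus F r < e"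
    by (auto simp: eventually_at dist_norm)
  show thesis
  proof (rule that[of "1 / d"])
    fix \<xi> :: 'a assume xi: "1 / d < norm \<xi>"
    then have pos: "0 < norm \<xi>" using \<open>d > 0\<close> by (auto intro: less_trans[rotated])
    define r where "r = (1 / (2 * (norm \<xi>)\<^sup>2)) *\<^sub>R \<xi>"
    have "r \<noteq> 0" using pos by (simp add: r_def)
    have "norm r = 1 / (2 * norm \<xi>)" using pos by (simp add: r_def power2_eq_square)
    also have "\<dots> < d" using xi pos \<open>d > 0\<close> by (simp add: field_simps)
    finally have "translation_modulus F r < e" using d \<open>r \<noteq> 0\<close> by simp
    have rxi: "r \<bullet> \<xi> = 1 / 2" using pos by (simp add: r_def power2_norm_eq_inner)
    define c where "c z = cis (- 2 * pi * (z \<bullet> \<xi>))" for z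
    have c: "c (z + r) = - c z" for z
    proof -
      have "c (z + r) = cis (- 2 * pi * (z \<bullet> \<xi>)) * cis (- pi)"
        by (simp add: c_def cis_mult inner_add_left rxi algebra_simps)
      then show ?thesis by (simp add: c_def complex_eq_iff)
    qed
    have i1: "integrable lborel (\<lambda>z. F z * c z)"
      unfolding c_def by (intro integrable_cis_mult F) measurable
    have i2: "integrable lborel (\<lambda>z. F (z + r) * c z)"
      unfolding c_def by (intro integrable_cis_mult integrable_lborel_translate F) measurable
    have "(LINT z|lborel. F z * c z) = (LINT z|lborel. F (z + r) * c (z + r))"
      by (rule integral_lborel_translate[symmetric]) (unfold c_def, measurable)
    also have "\<dots> = - (LINT z|lborel. F (z + r) * c z)" unfolding c by simp
    finally have "2 * (LINT z|lborel. F z * c z) = (LINT z|lborel. F z * c z) - (LINT z|lborel. F (z + r) * c z)"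
      by simp
    also have "\<dots> = (LINT z|lborel. F z * c z - F (z + r) * c z)"
      using i1 i2 by simp
    also have "cmod \<dots> \<le> (LINT z|lborel. cmod (F z * c z - F (z + r) * c z))"
      by (rule integral_norm_bound)
    also have "\<dots> = translation_modulus F r"
      unfolding translation_modulus_def
      by (intro Bochner_Integration.integral_cong refl)
        (simp add: c_def norm_mult norm_minus_commute flip: left_diff_distrib)
    also note \<open>translation_modulus F r < e\<close>
    finally have "2 * cmod (LINT z|lborel. F z * c z) < e" by (simp add: norm_mult)
    then show "cmod (LINT z|lborel. F z * cis (- 2 * pi * (z \<bullet> \<xi>))) < e"
      using \<open>e > 0\<close> by (simp add: c_def)
  qed
qed

text \<open>The squared modulus of the ambiguity function is a Fourier transform, by the orthogonality relation for \<open>f = g\<close>.\<close>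

theorem ambiguity_superlevel_bounded:
  assumes g: "square_integrable g" and "\<epsilon> > 0"
  shows "bounded {z. \<epsilon> < cmod (ambiguity g z)}"
proof -
  define S where "S z = complex_of_real ((cmod (STFT g g z))\<^sup>2)" for z
  have "integrable lebesgue S"
    unfolding S_def by (rule integrable_spectrogram[OF g g])
  then obtain S' where S' [measurable]: "S' \<in> borel_measurable borel" and ae: "AE z in lborel. S z = S' z"
    by (metis borel_representative borel_measurable_integrable)
  have int: "integrable lborel S'"
    using integrable_lebesgue_representative[OF S' ae] \<open>integrable lebesgue S\<close> by simp
  have four: "fourier2 S \<xi> = (LINT z|lborel. S' z * cis (- 2 * pi * (z \<bullet> \<xi>)))" for \<xi>
    unfolding fourier2_def
    by (rule integral_lebesgue_representative) (use ae in \<open>measurable, eventually_elim, simp\<close>)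
  have "\<epsilon>\<^sup>2 > 0" using \<open>\<epsilon> > 0\<close> by simp
  obtain R where R: "\<And>\<xi>. R < norm \<xi> \<Longrightarrow> cmod (fourier2 S \<xi>) < \<epsilon>\<^sup>2"
    using riemann_lebesgue[OF int \<open>\<epsilon>\<^sup>2 > 0\<close>] unfolding four by metis
  show ?thesis
  proof (rule boundedI)
    fix z assume z: "z \<in> {z. \<epsilon> < cmod (ambiguity g z)}"
    obtain x y where xy: "z = (x, y)" by force
    have "cmod (fourier2 S (y, - x)) = (cmod (ambiguity g z))\<^sup>2"
      unfolding S_def fourier2_spectrogram[OF g g] xy by (simp add: norm_mult power2_eq_square)
    also have "\<dots> \<ge> \<epsilon>\<^sup>2" using z \<open>\<epsilon> > 0\<close> by (intro power_mono) auto
    finally have "norm (y, - x) \<le> R" using R[of "(y, - x)"] by (meson not_le)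
    then show "norm z \<le> R" by (simp add: xy norm_prod_def add.commute)
  qed
qed

section \<open>Minkowski's integral inequality\<close>

text \<open>The \<open>L\<^sup>p\<close> norm over an arbitrary measure: Minkowski's inequality is used for Lebesgue measure and, to get the triangle
inequality, for a counting measure.\<close>

definition pnorm :: "'a measure \<Rightarrow> real \<Rightarrow> ('a \<Rightarrow> real) \<Rightarrow> ennreal" where
  "pnorm M p g = ennreal_powr (\<integral>\<^sup>+ x. ennreal (g x powr p) \<partial>M) (1 / p)"

lemma Lp_norm_eq_pnorm: "Lp_norm p g = pnorm lborel p (\<lambda>x. cmod (g x))"
  by (simp add: Lp_norm_def pnorm_def nn_integral_completion)

lemma mixed_norm_eq_pnorm: "mixed_norm p U = (\<integral>\<^sup>+ y. pnorm lborel p (\<lambda>x. cmod (U (x, y))) \<partial>lborel)"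
  by (simp add: mixed_norm_def Lp_norm_eq_pnorm nn_integral_completion)

lemma ennreal_powr_top [simp]: "ennreal_powr top r = top"
  by (simp add: ennreal_powr_def)

lemma ennreal_powr_ennreal [simp]: "0 \<le> a \<Longrightarrow> ennreal_powr (ennreal a) r = ennreal (a powr r)"
  by (simp add: ennreal_powr_def)

lemma ennreal_powr_0 [simp]: "ennreal_powr 0 r = 0"
  by (simp add: ennreal_powr_def)

lemma ennreal_powr_mono:
  assumes "0 \<le> r" "a \<le> b"
  shows "ennreal_powr a r \<le> ennreal_powr b r"
  using assms
  by (cases a rule: ennreal_cases; cases b rule: ennreal_cases)
    (auto simp: top_unique intro!: ennreal_leI powr_mono2)

lemma borel_measurable_ennreal_powr [measurable]: "(\<lambda>a. ennreal_powr a r) \<in> borel_measurable borel"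
  unfolding ennreal_powr_def by measurable

lemma pnorm_cong_AE:
  assumes "AE x in M. g x = h x"
  shows "pnorm M p g = pnorm M p h"
  unfolding pnorm_def using assms
  by (intro arg_cong2[of _ _ _ _ ennreal_powr] refl nn_integral_cong_AE) (auto elim: eventually_mono)

lemma pnorm_mono_AE:
  assumes "0 < p" "AE x in M. 0 \<le> g x \<and> g x \<le> h x"
  shows "pnorm M p g \<le> pnorm M p h"
  unfolding pnorm_def
proof (intro ennreal_powr_mono nn_integral_mono_AE)
  show "AE x in M. ennreal (g x powr p) \<le> ennreal (h x powr p)"
    using assms(2) by eventually_elim (use assms(1) in \<open>auto intro!: ennreal_leI powr_mono2\<close>)
qed (use assms(1) in auto)

lemma pnorm_finiteE:
  assumes "0 < p" "pnorm M p g < \<infinity>"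
  obtains a where "0 \<le> a" "pnorm M p g = ennreal a" "(\<integral>\<^sup>+ x. ennreal (g x powr p) \<partial>M) = ennreal (a powr p)"
proof -
  have "(\<integral>\<^sup>+ x. ennreal (g x powr p) \<partial>M) \<noteq> top"
    using assms(2) by (auto simp: pnorm_def)
  then obtain I where I: "0 \<le> I" "(\<integral>\<^sup>+ x. ennreal (g x powr p) \<partial>M) = ennreal I"
    by (cases "(\<integral>\<^sup>+ x. ennreal (g x powr p) \<partial>M)" rule: ennreal_cases) auto
  show thesis
    using I assms(1) by (intro that[of "I powr (1 / p)"]) (auto simp: pnorm_def powr_powr)
qed

lemma pnorm_cmult:
  assumes "0 < p" "0 \<le> c" and [measurable]: "g \<in> borel_measurable M" and "\<And>x. 0 \<le> g x"
  shows "pnorm M p (\<lambda>x. c * g x) = ennreal c * pnorm M p g"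
proof (cases "c = 0")
  case False
  have eq: "(\<integral>\<^sup>+ x. ennreal ((c * g x) powr p) \<partial>M) = ennreal (c powr p) * (\<integral>\<^sup>+ x. ennreal (g x powr p) \<partial>M)"
    using assms by (subst nn_integral_cmult[symmetric]) (auto simp: powr_mult ennreal_mult)
  show ?thesis
  proof (cases "(\<integral>\<^sup>+ x. ennreal (g x powr p) \<partial>M)" rule: ennreal_cases)
    case (real r)
    then show ?thesis using assms unfolding pnorm_def eq
      by (simp add: powr_mult powr_powr flip: ennreal_mult)
  next
    case top
    have "ennreal (c powr p) \<noteq> 0" "ennreal c \<noteq> 0" using False assms by auto
    then show ?thesis
      unfolding pnorm_def eq top by (simp add: ennreal_mult_top)
  qed
qed (use assms in \<open>simp add: pnorm_def\<close>)

text \<open>Young's inequality with conjugate exponents \<open>p\<close> and \<open>p / (p - 1)\<close>, in a form that includes \<open>p = 1\<close>.\<close>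

lemma young_powr:
  fixes s t p :: real
  assumes "1 \<le> p" "0 \<le> s" "0 \<le> t"
  shows "s * t powr (p - 1) \<le> s powr p / p + t powr p * (1 - 1 / p)"
proof (cases "p = 1")
  case False
  with assms have p: "p > 1" by simp
  define q where "q = p / (p - 1)"
  have q: "q > 1" "1 / p + 1 / q = 1" "1 / q = 1 - 1 / p" "(p - 1) * q = p"
    using p by (auto simp: q_def field_simps)
  have "s * t powr (p - 1) \<le> s powr p / p + (t powr (p - 1)) powr q / q"
    using assms p q by (intro Youngs_inequality) auto
  also have "(t powr (p - 1)) powr q / q = t powr p * (1 - 1 / p)"
    using q by (simp add: powr_powr divide_inverse)
  finally show ?thesis .
qed (use assms in \<open>auto simp: powr_def\<close>)

text \<open>Young's inequality, applied to functions scaled to unit norm and integrated.\<close>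

lemma holder_powr:
  fixes s t :: "'a \<Rightarrow> real"
  assumes p: "1 \<le> p" and [measurable]: "s \<in> borel_measurable M" "t \<in> borel_measurable M"
    and s0: "\<And>x. 0 \<le> s x" and t0: "\<And>x. 0 \<le> t x"
    and s: "(\<integral>\<^sup>+ x. ennreal (s x powr p) \<partial>M) = ennreal (\<alpha> powr p)" and "0 \<le> \<alpha>"
    and t: "(\<integral>\<^sup>+ x. ennreal (t x powr p) \<partial>M) = ennreal (\<beta> powr p)" and "0 < \<beta>"
  shows "(\<integral>\<^sup>+ x. ennreal (s x * t x powr (p - 1)) \<partial>M) \<le> ennreal (\<alpha> * \<beta> powr (p - 1))"
proof (cases "\<alpha> = 0")
  case True
  then have "AE x in M. ennreal (s x powr p) = 0"
    using s by (subst nn_integral_0_iff_AE[symmetric]) auto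
  then have "AE x in M. ennreal (s x * t x powr (p - 1)) = 0"
    by eventually_elim (use s0 in \<open>auto simp: ennreal_eq_0_iff not_le[symmetric]\<close>)
  then have "(\<integral>\<^sup>+ x. ennreal (s x * t x powr (p - 1)) \<partial>M) = 0"
    by (subst nn_integral_0_iff_AE) auto
  then show ?thesis by simp
next
  case False
  then have "\<alpha> > 0" using \<open>0 \<le> \<alpha>\<close> by simp
  \<comment> \<open>The coefficients that remain after undoing the scaling of \<open>s\<close> by \<open>\<alpha>\<close> and of \<open>t\<close> by \<open>\<beta>\<close>.\<close>
  define A B where "A = \<alpha> * \<beta> powr (p - 1) / (p * \<alpha> powr p)"
    and "B = \<alpha> * \<beta> powr (p - 1) * (1 - 1 / p) / \<beta> powr p"
  have AB: "0 \<le> A" "0 \<le> B" using p \<open>\<alpha> > 0\<close> \<open>\<beta> > 0\<close> by (auto simp: A_def B_def)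
  have pt: "s x * t x powr (p - 1) \<le> A * s x powr p + B * t x powr p" for x
  proof -
    have "\<alpha> * \<beta> powr (p - 1) * ((s x / \<alpha>) * (t x / \<beta>) powr (p - 1))
       \<le> \<alpha> * \<beta> powr (p - 1) * ((s x / \<alpha>) powr p / p + (t x / \<beta>) powr p * (1 - 1 / p))"
      using p s0 t0 \<open>\<alpha> > 0\<close> \<open>\<beta> > 0\<close> by (intro mult_left_mono young_powr) auto
    moreover have "\<alpha> * \<beta> powr (p - 1) * ((s x / \<alpha>) * (t x / \<beta>) powr (p - 1)) = s x * t x powr (p - 1)"
      using t0 \<open>\<alpha> > 0\<close> \<open>\<beta> > 0\<close> by (simp add: powr_divide)
    moreover have "\<alpha> * \<beta> powr (p - 1) * ((s x / \<alpha>) powr p / p + (t x / \<beta>) powr p * (1 - 1 / p))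
       = A * s x powr p + B * t x powr p"
      using s0 t0 \<open>\<alpha> > 0\<close> \<open>\<beta> > 0\<close> by (simp add: powr_divide A_def B_def distrib_left mult_ac)
    ultimately show ?thesis by simp
  qed
  have "(\<integral>\<^sup>+ x. ennreal (s x * t x powr (p - 1)) \<partial>M)
      \<le> (\<integral>\<^sup>+ x. ennreal A * ennreal (s x powr p) + ennreal B * ennreal (t x powr p) \<partial>M)"
    using pt AB by (intro nn_integral_mono) (simp add: ennreal_mult[symmetric] ennreal_plus[symmetric] ennreal_leI del: ennreal_plus)
  also have "\<dots> = ennreal A * ennreal (\<alpha> powr p) + ennreal B * ennreal (\<beta> powr p)"
    by (simp add: nn_integral_add nn_integral_cmult s t)
  also have "\<dots> = ennreal (A * \<alpha> powr p + B * \<beta> powr p)"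
    using AB by (simp add: ennreal_mult)
  also have "A * \<alpha> powr p + B * \<beta> powr p = \<alpha> * \<beta> powr (p - 1)"
  proof -
    have "A * \<alpha> powr p = \<alpha> * \<beta> powr (p - 1) * (1 / p)"
      using \<open>\<alpha> > 0\<close> p by (simp add: A_def)
    moreover have "B * \<beta> powr p = \<alpha> * \<beta> powr (p - 1) * (1 - 1 / p)"
      using \<open>\<beta> > 0\<close> by (simp add: B_def)
    ultimately show ?thesis by (simp add: right_diff_distrib)
  qed
  finally show ?thesis .
qed

lemma borel_measurable_pnorm [measurable]:
  assumes "sigma_finite_measure M1" "(\<lambda>(x, y). w x y) \<in> borel_measurable (M1 \<Otimes>\<^sub>M M2)"
  shows "(\<lambda>y. pnorm M1 p (\<lambda>x. w x y)) \<in> borel_measurable M2"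
proof -
  interpret sigma_finite_measure M1 by fact
  note [measurable] = assms(2)
  have "(\<lambda>y. \<integral>\<^sup>+ x. ennreal (w x y powr p) \<partial>M1) \<in> borel_measurable M2"
    by measurable
  then show ?thesis unfolding pnorm_def by measurable
qed

text \<open>Write \<open>g\<^sup>p = g \<cdot> g\<^bsup>p-1\<^esup>\<close>, replace the first factor by the integral of \<open>w\<close>, exchange the integrals and apply Hoelder's inequality for
fixed \<open>y\<close>. Cancelling \<open>\<parallel>g\<parallel>\<^bsup>p-1\<^esup>\<close> requires it to be finite.\<close>

lemma minkowski_integral_finite:
  fixes w :: "'a \<Rightarrow> 'b \<Rightarrow> real"
  assumes "sigma_finite_measure M1" "sigma_finite_measure M2"
    and p: "1 \<le> p" and [measurable]: "(\<lambda>(x, y). w x y) \<in> borel_measurable (M1 \<Otimes>\<^sub>M M2)"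
    and w0: "\<And>x y. 0 \<le> w x y"
    and [measurable]: "g \<in> borel_measurable M1" and g0: "\<And>x. 0 \<le> g x"
    and le: "AE x in M1. ennreal (g x) \<le> (\<integral>\<^sup>+ y. ennreal (w x y) \<partial>M2)"
    and fin: "(\<integral>\<^sup>+ x. ennreal (g x powr p) \<partial>M1) < \<infinity>"
  shows "pnorm M1 p g \<le> (\<integral>\<^sup>+ y. pnorm M1 p (\<lambda>x. w x y) \<partial>M2)"
proof -
  interpret M1: sigma_finite_measure M1 by fact
  interpret M2: sigma_finite_measure M2 by fact
  interpret P: pair_sigma_finite M1 M2 ..
  define Q where "Q = (\<integral>\<^sup>+ y. pnorm M1 p (\<lambda>x. w x y) \<partial>M2)"
  have [measurable]: "(\<lambda>y. pnorm M1 p (\<lambda>x. w x y)) \<in> borel_measurable M2"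
    by (rule borel_measurable_pnorm) (auto intro: assms)
  have "pnorm M1 p g < \<infinity>"
    using fin by (cases "(\<integral>\<^sup>+ x. ennreal (g x powr p) \<partial>M1)" rule: ennreal_cases) (auto simp: pnorm_def)
  then obtain b where b: "0 \<le> b" "pnorm M1 p g = ennreal b"
      "(\<integral>\<^sup>+ x. ennreal (g x powr p) \<partial>M1) = ennreal (b powr p)"
    using p pnorm_finiteE[of p M1 g] by auto
  show ?thesis
  proof (cases "b = 0 \<or> Q = \<infinity>")
    case True
    then show ?thesis using b by (auto simp: Q_def)
  next
    case False
    then have "b > 0" "Q < \<infinity>" using b by (auto simp: less_top)
    then obtain q where q: "0 \<le> q" "Q = ennreal q" by (cases Q rule: ennreal_cases) auto
    have "AE y in M2. pnorm M1 p (\<lambda>x. w x y) \<noteq> \<infinity>"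
      using \<open>Q < \<infinity>\<close> by (intro nn_integral_PInf_AE) (auto simp: Q_def)
    then have holder: "AE y in M2. (\<integral>\<^sup>+ x. ennreal (w x y * g x powr (p - 1)) \<partial>M1)
        \<le> pnorm M1 p (\<lambda>x. w x y) * ennreal (b powr (p - 1))"
      using AE_space
    proof eventually_elim
      case (elim y)
      then have [measurable]: "y \<in> space M2" by simp
      obtain a where a: "0 \<le> a" "pnorm M1 p (\<lambda>x. w x y) = ennreal a"
        "(\<integral>\<^sup>+ x. ennreal (w x y powr p) \<partial>M1) = ennreal (a powr p)"
        using elim p pnorm_finiteE[of p M1 "\<lambda>x. w x y"] by (auto simp: less_top)
      have "(\<integral>\<^sup>+ x. ennreal (w x y * g x powr (p - 1)) \<partial>M1) \<le> ennreal (a * b powr (p - 1))"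
        by (rule holder_powr[OF p]) (use a b w0 g0 \<open>b > 0\<close> in auto)
      then show ?case using a by (simp add: ennreal_mult)
    qed
    have "ennreal (b powr p) = (\<integral>\<^sup>+ x. ennreal (g x) * ennreal (g x powr (p - 1)) \<partial>M1)"
      unfolding b(3)[symmetric]
    proof (intro nn_integral_cong)
      fix x
      have "g x powr p = g x * g x powr (p - 1)"
        using g0[of x] by (cases "g x = 0") (auto simp: powr_diff)
      then show "ennreal (g x powr p) = ennreal (g x) * ennreal (g x powr (p - 1))"
        using g0[of x] by (simp add: ennreal_mult)
    qed
    also have "\<dots> \<le> (\<integral>\<^sup>+ x. (\<integral>\<^sup>+ y. ennreal (w x y) \<partial>M2) * ennreal (g x powr (p - 1)) \<partial>M1)"
      using le by (intro nn_integral_mono_AE) (auto elim!: eventually_mono intro: mult_right_mono)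
    also have "\<dots> = (\<integral>\<^sup>+ x. (\<integral>\<^sup>+ y. ennreal (w x y * g x powr (p - 1)) \<partial>M2) \<partial>M1)"
    proof (rule nn_integral_cong)
      fix x assume [measurable]: "x \<in> space M1"
      show "(\<integral>\<^sup>+ y. ennreal (w x y) \<partial>M2) * ennreal (g x powr (p - 1))
          = (\<integral>\<^sup>+ y. ennreal (w x y * g x powr (p - 1)) \<partial>M2)"
        using w0 by (subst nn_integral_multc[symmetric]) (auto simp: ennreal_mult)
    qed
    also have "\<dots> = (\<integral>\<^sup>+ y. (\<integral>\<^sup>+ x. ennreal (w x y * g x powr (p - 1)) \<partial>M1) \<partial>M2)"
      by (rule P.Fubini'[symmetric]) measurable
    also have "\<dots> \<le> (\<integral>\<^sup>+ y. pnorm M1 p (\<lambda>x. w x y) * ennreal (b powr (p - 1)) \<partial>M2)"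
      by (intro nn_integral_mono_AE holder)
    also have "\<dots> = Q * ennreal (b powr (p - 1))"
      unfolding Q_def by (rule nn_integral_multc) measurable
    also have "\<dots> = ennreal (q * b powr (p - 1))"
      using q by (simp add: ennreal_mult)
    finally have "b powr p \<le> q * b powr (p - 1)"
      using q by simp
    moreover have "b powr p = b * b powr (p - 1)"
      using \<open>b > 0\<close> by (simp add: powr_diff)
    ultimately have "b \<le> q" using \<open>b > 0\<close> by simp
    then show ?thesis using b q by (simp add: Q_def[symmetric] ennreal_leI)
  qed
qed

text \<open>The finite case applies to truncations of \<open>g\<close> in range and domain, which increase to \<open>g\<close>.\<close>

theorem minkowski_integral:
  fixes w :: "'a \<Rightarrow> 'b \<Rightarrow> real"
  assumes "sigma_finite_measure M1" "sigma_finite_measure M2"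
    and p: "1 \<le> p" and w: "(\<lambda>(x, y). w x y) \<in> borel_measurable (M1 \<Otimes>\<^sub>M M2)"
    and w0: "\<And>x y. 0 \<le> w x y"
    and [measurable]: "g \<in> borel_measurable M1" and g0: "\<And>x. 0 \<le> g x"
    and le: "AE x in M1. ennreal (g x) \<le> (\<integral>\<^sup>+ y. ennreal (w x y) \<partial>M2)"
  shows "pnorm M1 p g \<le> (\<integral>\<^sup>+ y. pnorm M1 p (\<lambda>x. w x y) \<partial>M2)"
proof -
  interpret M1: sigma_finite_measure M1 by fact
  define Q where "Q = (\<integral>\<^sup>+ y. pnorm M1 p (\<lambda>x. w x y) \<partial>M2)"
  obtain E :: "nat \<Rightarrow> 'a set" where E: "range E \<subseteq> sets M1" "(\<Union>i. E i) = space M1"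
      "\<And>i. emeasure M1 (E i) \<noteq> \<infinity>" "incseq E"
    using M1.sigma_finite_incseq by metis
  have [measurable]: "E i \<in> sets M1" for i using E(1) by auto
  define h where "h n x = indicator (E n) x * min (g x) (real n)" for n x
  have h0: "0 \<le> h n x" for n x using g0 by (simp add: h_def)
  have hg: "h n x \<le> g x" for n x using g0[of x] by (auto simp: h_def indicator_def)
  have [measurable]: "h n \<in> borel_measurable M1" for n unfolding h_def by measurable
  have hQ: "pnorm M1 p (h n) \<le> Q" for n
    unfolding Q_def
  proof (rule minkowski_integral_finite[OF assms(1,2) p w w0])
    show "AE x in M1. ennreal (h n x) \<le> (\<integral>\<^sup>+ y. ennreal (w x y) \<partial>M2)"
      using le by eventually_elim (use hg in \<open>blast intro: order_trans ennreal_leI\<close>)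
    have "(\<integral>\<^sup>+ x. ennreal (h n x powr p) \<partial>M1) \<le> (\<integral>\<^sup>+ x. ennreal (real n powr p) * indicator (E n) x \<partial>M1)"
      using g0 p by (intro nn_integral_mono)
        (auto simp: h_def indicator_def intro!: ennreal_leI powr_mono2)
    also have "\<dots> = ennreal (real n powr p) * emeasure M1 (E n)"
      by (rule nn_integral_cmult_indicator) simp
    also have "\<dots> < \<infinity>" using E(3)[of n] by (simp add: ennreal_mult_less_top less_top)
    finally show "(\<integral>\<^sup>+ x. ennreal (h n x powr p) \<partial>M1) < \<infinity>" .
  qed (use h0 in auto)
  show ?thesis
  proof (cases "Q = \<infinity>")
    case False
    then obtain q where q: "0 \<le> q" "Q = ennreal q" by (cases Q rule: ennreal_cases) auto
    have hq: "(\<integral>\<^sup>+ x. ennreal (h n x powr p) \<partial>M1) \<le> ennreal (q powr p)" for n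
    proof -
      have "pnorm M1 p (h n) < \<infinity>" using hQ[of n] q by (simp add: le_less_trans)
      then obtain a where a: "0 \<le> a" "pnorm M1 p (h n) = ennreal a"
        "(\<integral>\<^sup>+ x. ennreal (h n x powr p) \<partial>M1) = ennreal (a powr p)"
        using p pnorm_finiteE[of p M1 "h n"] by auto
      then have "a \<le> q" using hQ[of n] q by simp
      then show ?thesis using a p by (simp add: powr_mono2 ennreal_leI)
    qed
    have inc: "h i x \<le> h j x" if "i \<le> j" for i j x
      using that g0[of x] incseqD[OF \<open>incseq E\<close> that] by (auto simp: h_def indicator_def)
    have "(\<integral>\<^sup>+ x. ennreal (g x powr p) \<partial>M1) = (\<integral>\<^sup>+ x. (SUP n. ennreal (h n x powr p)) \<partial>M1)"
    proof (rule nn_integral_cong)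
      fix x assume "x \<in> space M1"
      then obtain i where i: "x \<in> E i" using E(2) by auto
      obtain j :: nat where j: "g x \<le> real j" using real_arch_simple by blast
      have "h (max i j) x = g x"
        using j i incseqD[OF \<open>incseq E\<close>, of i "max i j"] by (auto simp: h_def)
      then show "ennreal (g x powr p) = (SUP n. ennreal (h n x powr p))"
        using hg h0 p
        by (intro antisym SUP_upper2[of "max i j"] SUP_least) (auto intro!: ennreal_leI powr_mono2)
    qed
    also have "\<dots> = (SUP n. \<integral>\<^sup>+ x. ennreal (h n x powr p) \<partial>M1)"
      using inc h0 p by (intro nn_integral_monotone_convergence_SUP)
        (auto simp: incseq_def le_fun_def intro!: ennreal_leI powr_mono2)
    also have "\<dots> \<le> ennreal (q powr p)" by (intro SUP_least hq)
    finally have "pnorm M1 p g \<le> ennreal_powr (ennreal (q powr p)) (1 / p)"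
      unfolding pnorm_def using p by (intro ennreal_powr_mono) auto
    also have "\<dots> = Q" using q p by (simp add: powr_powr)
    finally show ?thesis unfolding Q_def .
  qed (simp add: Q_def)
qed

text \<open>Minkowski's integral inequality over a space with two points.\<close>

lemma pnorm_triangle:
  assumes "sigma_finite_measure M" "1 \<le> p"
    and [measurable]: "f \<in> borel_measurable M" "g \<in> borel_measurable M"
    and f0: "\<And>x. 0 \<le> f x" and g0: "\<And>x. 0 \<le> g x"
  shows "pnorm M p (\<lambda>x. f x + g x) \<le> pnorm M p f + pnorm M p g"
proof -
  have "pnorm M p (\<lambda>x. f x + g x)
      \<le> (\<integral>\<^sup>+ b. pnorm M p (\<lambda>x. if b then f x else g x) \<partial>count_space (UNIV :: bool set))"
  proof (rule minkowski_integral[OF assms(1) _ assms(2)])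
    show "sigma_finite_measure (count_space (UNIV :: bool set))"
      by (rule sigma_finite_measure_count_space_finite) simp
    show "AE x in M. ennreal (f x + g x)
        \<le> (\<integral>\<^sup>+ b. ennreal (if b then f x else g x) \<partial>count_space (UNIV :: bool set))"
      using f0 g0 by (intro AE_I2) (simp add: nn_integral_count_space_finite UNIV_bool add.commute)
  qed (use f0 g0 in \<open>auto\<close>)
  then show ?thesis
    by (simp add: nn_integral_count_space_finite UNIV_bool add.commute)
qed

section \<open>Mixed norms and phase integrals\<close>

lemma sigma_finite_lebesgue: "sigma_finite_measure (lebesgue :: 'a::euclidean_space measure)"
proof
  obtain A :: "'a set set" where A: "countable A" "A \<subseteq> sets lborel" "\<Union>A = space lborel"
      "\<forall>a\<in>A. emeasure lborel a \<noteq> \<infinity>"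
    using lborel.sigma_finite_countable by blast
  show "\<exists>A :: 'a set set. countable A \<and> A \<subseteq> sets lebesgue \<and> \<Union>A = space lebesgue
      \<and> (\<forall>a\<in>A. emeasure lebesgue a \<noteq> \<infinity>)"
    using A by (intro exI[of _ A]) auto
qed

lemma Lp_norm_eq_pnorm_lebesgue: "Lp_norm p g = pnorm lebesgue p (\<lambda>x. cmod (g x))"
  by (simp add: Lp_norm_def pnorm_def)

lemma AE_lborel_sections:
  fixes P :: "'a::euclidean_space \<times> 'b::euclidean_space \<Rightarrow> bool"
  assumes "AE z in lborel. P z"
  shows "AE x in lborel. AE y in lborel. P (x, y)" "AE y in lborel. AE x in lborel. P (x, y)"
proof -
  have ae: "AE z in lborel \<Otimes>\<^sub>M lborel. P z" unfolding lborel_prod by (rule assms)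
  then show "AE x in lborel. AE y in lborel. P (x, y)" by (rule lborel_pair.AE_pair)
  obtain N where N: "N \<in> sets (lborel \<Otimes>\<^sub>M lborel)" "N \<in> null_sets (lborel \<Otimes>\<^sub>M lborel)" "{z. \<not> P z} \<subseteq> N"
    using ae by (auto elim!: AE_E simp: null_sets_def space_pair_measure)
  have "AE z in lborel \<Otimes>\<^sub>M lborel. z \<notin> N" using N(2) by (rule AE_not_in)
  then have "AE x in lborel. AE y in lborel. (x, y) \<notin> N" by (rule lborel_pair.AE_pair)
  moreover have [measurable]: "N \<in> sets (lborel \<Otimes>\<^sub>M lborel)" by fact
  ultimately have "AE y in lborel. AE x in lborel. (x, y) \<notin> N"
    by (subst lborel_pair.AE_commute[symmetric]) measurable
  then show "AE y in lborel. AE x in lborel. P (x, y)"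
    by eventually_elim (erule eventually_mono, use N(3) in auto)
qed

lemma mixed_norm_cong_AE:
  assumes "AE z in lborel. U z = V z"
  shows "mixed_norm p U = mixed_norm p V"
  unfolding mixed_norm_eq_pnorm
proof (rule nn_integral_cong_AE)
  show "AE y in lborel. pnorm lborel p (\<lambda>x. cmod (U (x, y))) = pnorm lborel p (\<lambda>x. cmod (V (x, y)))"
    using AE_lborel_sections(2)[OF assms]
    by eventually_elim (rule pnorm_cong_AE, erule eventually_mono, simp)
qed

lemma mixed_norm_mono:
  assumes "0 < p" "\<And>z. cmod (U z) \<le> cmod (V z)"
  shows "mixed_norm p U \<le> mixed_norm p V"
  unfolding mixed_norm_eq_pnorm using assms by (intro nn_integral_mono pnorm_mono_AE) auto

lemma mixed_norm_cmult:
  assumes "0 < p" "0 \<le> c" "U \<in> borel_measurable lebesgue"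
  shows "mixed_norm p (\<lambda>z. complex_of_real c * U z) = ennreal c * mixed_norm p U"
proof -
  obtain U' where m: "U' \<in> borel_measurable borel" and U': "AE z in lborel. U z = U' z"
    using borel_representative[OF assms(3)] .
  have [measurable]: "U' \<in> borel_measurable (borel \<Otimes>\<^sub>M borel)"
    using m by (simp add: borel_prod)
  have "mixed_norm p (\<lambda>z. complex_of_real c * U z) = mixed_norm p (\<lambda>z. complex_of_real c * U' z)"
    by (rule mixed_norm_cong_AE) (use U' in \<open>eventually_elim, simp\<close>)
  also have "\<dots> = (\<integral>\<^sup>+ y. ennreal c * pnorm lborel p (\<lambda>x. cmod (U' (x, y))) \<partial>lborel)"
    unfolding mixed_norm_eq_pnorm
    by (intro nn_integral_cong)
      (subst pnorm_cmult[symmetric], use assms in \<open>auto simp: norm_mult\<close>)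
  also have "\<dots> = ennreal c * (\<integral>\<^sup>+ y. pnorm lborel p (\<lambda>x. cmod (U' (x, y))) \<partial>lborel)"
    by (intro nn_integral_cmult borel_measurable_pnorm sigma_finite_lborel) simp
  also have "\<dots> = ennreal c * mixed_norm p U"
    unfolding mixed_norm_eq_pnorm[symmetric] using mixed_norm_cong_AE[OF U', of p] by simp
  finally show ?thesis .
qed

lemma phase_integral_representative:
  assumes [measurable]: "U' \<in> borel_measurable borel" and "AE z in lborel. U z = U' z"
  shows "AE x in lborel. phase_integral U x = (LINT y|lborel. U' (x, y) * cis (pi * x * y))"
  using AE_lborel_sections(1)[OF assms(2)]
proof eventually_elim
  case (elim x)
  have "(\<lambda>y. U' (x, y)) \<in> borel_measurable borel"
    by (rule measurable_compose[OF _ assms(1)]) (simp add: borel_prod[symmetric])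
  then show ?case
    unfolding phase_integral_def
    by (intro integral_lebesgue_representative) (use elim in \<open>auto elim: eventually_mono\<close>)
qed

lemma borel_measurable_phase_integral:
  assumes "U \<in> borel_measurable lebesgue"
  shows "phase_integral U \<in> borel_measurable lebesgue"
proof -
  obtain U' where U': "U' \<in> borel_measurable borel" and ae: "AE z in lborel. U z = U' z"
    using borel_representative[OF assms] .
  have [measurable]: "U' \<in> borel_measurable (borel \<Otimes>\<^sub>M borel)"
    using U' by (simp add: borel_prod)
  have "(\<lambda>x. LINT y|lborel. U' (x, y) * cis (pi * x * y)) \<in> borel_measurable borel"
    by measurable
  then show ?thesis
    by (rule measurable_lebesgue_representative) (rule phase_integral_representative[OF U' ae])
qed

text \<open>The Bochner integral of a function that is not integrable is \<open>0\<close>. The estimate survives this convention, because the right-hand side is infinite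
when exactly one of the two functions is integrable, and both integrals vanish when neither is.\<close>

lemma norm_integral_diff_le:
  fixes a b :: "'a \<Rightarrow> complex"
  assumes [measurable]: "a \<in> borel_measurable M" "b \<in> borel_measurable M"
  shows "ennreal (cmod ((LINT y|M. a y) - (LINT y|M. b y))) \<le> (\<integral>\<^sup>+ y. ennreal (cmod (a y - b y)) \<partial>M)"
proof (cases "(\<integral>\<^sup>+ y. ennreal (cmod (a y - b y)) \<partial>M) = \<infinity>")
  case False
  then have d: "integrable M (\<lambda>y. a y - b y)"
    by (auto simp: integrable_iff_bounded less_top)
  show ?thesis
  proof (cases "integrable M a")
    case True
    have "integrable M (\<lambda>y. a y - (a y - b y))"
      using True d by (rule Bochner_Integration.integrable_diff)
    then have "integrable M b" by simp
    then have "(LINT y|M. a y) - (LINT y|M. b y) = (LINT y|M. a y - b y)"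
      using True by simp
    then show ?thesis using integral_norm_bound_ennreal[OF d] by simp
  next
    case False
    have "\<not> integrable M b"
    proof
      assume "integrable M b"
      from Bochner_Integration.integrable_add[OF d this] False show False by simp
    qed
    then show ?thesis using False by (simp add: not_integrable_integral_eq)
  qed
qed simp

lemma phase_integral_diff_le:
  assumes [measurable]: "(\<lambda>y. U (x, y)) \<in> borel_measurable lebesgue" "(\<lambda>y. V (x, y)) \<in> borel_measurable lebesgue"
  shows "ennreal (cmod (phase_integral U x - phase_integral V x))
      \<le> (\<integral>\<^sup>+ y. ennreal (cmod (U (x, y) - V (x, y))) \<partial>lebesgue)"
proof -
  have [measurable]: "(\<lambda>y. cis (pi * x * y)) \<in> borel_measurable lebesgue"
    by (rule measurable_completion) measurable
  show ?thesis
    unfolding phase_integral_def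
    using norm_integral_diff_le[of "\<lambda>y. U (x, y) * cis (pi * x * y)" lebesgue "\<lambda>y. V (x, y) * cis (pi * x * y)"]
    by (simp add: norm_mult flip: left_diff_distrib)
qed

lemma Lp_norm_phase_integral_diff:
  assumes p: "1 \<le> p" and "U \<in> borel_measurable lebesgue" "V \<in> borel_measurable lebesgue"
  shows "Lp_norm p (\<lambda>x. phase_integral U x - phase_integral V x) \<le> mixed_norm p (\<lambda>z. U z - V z)"
proof -
  obtain U' where U': "U' \<in> borel_measurable borel" and aeU: "AE z in lborel. U z = U' z"
    using borel_representative[OF assms(2)] .
  obtain V' where V': "V' \<in> borel_measurable borel" and aeV: "AE z in lborel. V z = V' z"
    using borel_representative[OF assms(3)] .
  have [measurable]: "U' \<in> borel_measurable (borel \<Otimes>\<^sub>M borel)" "V' \<in> borel_measurable (borel \<Otimes>\<^sub>M borel)"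
    using U' V' by (simp_all add: borel_prod)
  define I where "I W x = (LINT y|lborel. W (x, y) * cis (pi * x * y))" for W :: "real \<times> real \<Rightarrow> complex" and x
  have [measurable]: "I U' \<in> borel_measurable borel" "I V' \<in> borel_measurable borel"
    unfolding I_def by measurable
  have "Lp_norm p (\<lambda>x. phase_integral U x - phase_integral V x) = pnorm lborel p (\<lambda>x. cmod (I U' x - I V' x))"
    unfolding Lp_norm_eq_pnorm I_def
    by (rule pnorm_cong_AE)
      (use phase_integral_representative[OF U' aeU] phase_integral_representative[OF V' aeV] in
        \<open>eventually_elim, simp\<close>)
  also have "\<dots> \<le> (\<integral>\<^sup>+ y. pnorm lborel p (\<lambda>x. cmod (U' (x, y) - V' (x, y))) \<partial>lborel)"
  proof (rule minkowski_integral[OF sigma_finite_lborel sigma_finite_lborel p])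
    show "AE x in lborel. ennreal (cmod (I U' x - I V' x)) \<le> (\<integral>\<^sup>+ y. ennreal (cmod (U' (x, y) - V' (x, y))) \<partial>lborel)"
    proof (rule AE_I2)
      fix x
      have "ennreal (cmod (I U' x - I V' x))
          \<le> (\<integral>\<^sup>+ y. ennreal (cmod (U' (x, y) * cis (pi * x * y) - V' (x, y) * cis (pi * x * y))) \<partial>lborel)"
        unfolding I_def by (rule norm_integral_diff_le) simp_all
      then show "ennreal (cmod (I U' x - I V' x)) \<le> (\<integral>\<^sup>+ y. ennreal (cmod (U' (x, y) - V' (x, y))) \<partial>lborel)"
        by (simp add: norm_mult flip: left_diff_distrib)
    qed
  qed simp_all
  also have "\<dots> = mixed_norm p (\<lambda>z. U' z - V' z)" by (simp add: mixed_norm_eq_pnorm)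
  also have "\<dots> = mixed_norm p (\<lambda>z. U z - V z)"
    by (rule mixed_norm_cong_AE) (use aeU aeV in \<open>eventually_elim, simp\<close>)
  finally show ?thesis .
qed

lemma Lp_norm_phase_integral:
  assumes "1 \<le> p" "U \<in> borel_measurable lebesgue"
  shows "Lp_norm p (phase_integral U) \<le> mixed_norm p U"
  using Lp_norm_phase_integral_diff[OF assms, of "\<lambda>_. 0"] by (simp add: phase_integral_def[abs_def])

text \<open>From \<open>\<bar>a\<^sup>2 - b\<^sup>2\<bar> = \<bar>a - b\<bar> (a + b)\<close> and \<open>2 sqrt (a b) \<le> a + b\<close>.\<close>

lemma abs_inverse_diff_le:
  fixes a b :: real
  assumes "0 < a" "0 < b"
  shows "\<bar>1 / a - 1 / b\<bar> \<le> 1 / (2 * (a * b) powr (3 / 2)) * \<bar>a\<^sup>2 - b\<^sup>2\<bar>"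
proof -
  define s where "s = sqrt (a * b)"
  have s: "s > 0" "s\<^sup>2 = a * b" using assms by (auto simp: s_def)
  have "0 \<le> (sqrt a - sqrt b)\<^sup>2" by simp
  then have amgm: "2 * s \<le> a + b"
    using assms by (simp add: power2_diff s_def real_sqrt_mult)
  have "(a * b) powr (3 / 2) = (a * b) powr (1 + 1 / 2)" by simp
  also have "\<dots> = s\<^sup>2 * s" using assms s(2) by (simp only: powr_add) (simp add: s_def powr_half_sqrt)
  finally have pw: "(a * b) powr (3 / 2) = s\<^sup>2 * s" .
  have "\<bar>1 / a - 1 / b\<bar> = \<bar>a - b\<bar> / s\<^sup>2"
  proof -
    have "1 / a - 1 / b = (b - a) / s\<^sup>2" using assms s(2) by (simp add: field_simps)
    then show ?thesis by (simp add: abs_minus_commute)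
  qed
  moreover have "\<bar>a\<^sup>2 - b\<^sup>2\<bar> = \<bar>a - b\<bar> * (a + b)"
    using assms by (simp add: power2_eq_square square_diff_square_factored abs_mult mult.commute)
  moreover have "\<bar>a - b\<bar> / s\<^sup>2 \<le> 1 / (2 * (s\<^sup>2 * s)) * (\<bar>a - b\<bar> * (a + b))"
  proof -
    have "\<bar>a - b\<bar> / s\<^sup>2 = 1 / (2 * (s\<^sup>2 * s)) * (\<bar>a - b\<bar> * (2 * s))" using s by simp
    also have "\<dots> \<le> 1 / (2 * (s\<^sup>2 * s)) * (\<bar>a - b\<bar> * (a + b))"
    proof (intro mult_left_mono amgm)
      show "0 \<le> 1 / (2 * (s\<^sup>2 * s))" using s(1) by simp
    qed simp
    finally show ?thesis .
  qed
  ultimately show ?thesis by (simp only: pw)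
qed

lemma Lp_norm_1_eq_integral:
  assumes "integrable lebesgue F"
  shows "Lp_norm 1 F = ennreal (LINT z|lebesgue. cmod (F z))"
proof -
  have "(\<integral>\<^sup>+ z. ennreal (cmod (F z)) \<partial>lebesgue) = ennreal (LINT z|lebesgue. cmod (F z))"
    using assms by (intro nn_integral_eq_integral) auto
  then show ?thesis by (simp add: Lp_norm_def integral_nonneg_AE)
qed

section \<open>Hermite windows and noisy spectrograms\<close>

lemma deriv_gaussian_poly:
  "\<exists>P :: real poly. (deriv ^^ n) (\<lambda>s :: real. exp (- 2 * pi * s\<^sup>2)) = (\<lambda>s. poly P s * exp (- 2 * pi * s\<^sup>2))"
proof (induction n)
  case 0
  show ?case by (intro exI[of _ 1]) simp
next
  case (Suc n)
  then obtain P where P: "(deriv ^^ n) (\<lambda>s :: real. exp (- 2 * pi * s\<^sup>2)) = (\<lambda>s. poly P s * exp (- 2 * pi * s\<^sup>2))"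
    by blast
  have "((\<lambda>s. poly P s * exp (- 2 * pi * s\<^sup>2)) has_field_derivative
      poly (pderiv P + P * [:0, - 4 * pi:]) t * exp (- 2 * pi * t\<^sup>2)) (at t)" for t
    by (auto intro!: derivative_eq_intros simp: algebra_simps)
  then have "deriv (\<lambda>s. poly P s * exp (- 2 * pi * s\<^sup>2))
      = (\<lambda>t. poly (pderiv P + P * [:0, - 4 * pi:]) t * exp (- 2 * pi * t\<^sup>2))"
    by (intro ext DERIV_imp_deriv)
  then show ?case
    by (intro exI[of _ "pderiv P + P * [:0, - 4 * pi:]"]) (simp only: funpow.simps comp_apply P)
qed

lemma square_integrable_hermite:
  assumes "is_hermite_function n h"
  shows "square_integrable h"
proof -
  obtain c where c: "\<And>t. h t = c * complex_of_real
         (exp (pi * t\<^sup>2) * (deriv ^^ n) (\<lambda>s :: real. exp (- 2 * pi * s\<^sup>2)) t)"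
    and int: "has_bochner_integral lebesgue (\<lambda>t. (cmod (h t))\<^sup>2) 1"
    using assms unfolding is_hermite_function_def by blast
  obtain P where P: "(deriv ^^ n) (\<lambda>s :: real. exp (- 2 * pi * s\<^sup>2)) = (\<lambda>s. poly P s * exp (- 2 * pi * s\<^sup>2))"
    using deriv_gaussian_poly by blast
  have "h = (\<lambda>t. c * complex_of_real (exp (pi * t\<^sup>2) * (poly P t * exp (- 2 * pi * t\<^sup>2))))"
    using c unfolding P by (intro ext)
  moreover have "(\<lambda>t. c * complex_of_real (exp (pi * t\<^sup>2) * (poly P t * exp (- 2 * pi * t\<^sup>2)))) \<in> borel_measurable borel"
    by (intro borel_measurable_continuous_onI continuous_intros)
  ultimately have "h \<in> borel_measurable lebesgue" by (simp add: measurable_completion)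
  then show ?thesis using int by (auto simp: square_integrable_def has_bochner_integral_iff)
qed

lemma borel_measurable_fourier2:
  assumes "integrable lebesgue F"
  shows "fourier2 F \<in> borel_measurable borel"
proof -
  obtain F' where F' [measurable]: "F' \<in> borel_measurable borel" and ae: "AE z in lborel. F z = F' z"
    using assms by (metis borel_representative borel_measurable_integrable)
  have "fourier2 F \<xi> = (LINT z|lborel. F' z * cis (- 2 * pi * (z \<bullet> \<xi>)))" for \<xi>
    unfolding fourier2_def
    by (rule integral_lebesgue_representative) (use ae in \<open>measurable, eventually_elim, simp\<close>)
  then have "fourier2 F = (\<lambda>\<xi>. LINT z|lborel. F' z * cis (- 2 * pi * (z \<bullet> \<xi>)))" by (rule ext)
  also have "\<dots> \<in> borel_measurable borel" by measurable
  finally show ?thesis .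
qed

lemma integrable_lebesgue_cis:
  assumes "integrable lebesgue F" "(\<theta> :: 'a::euclidean_space \<Rightarrow> real) \<in> borel_measurable borel"
  shows "integrable lebesgue (\<lambda>z. F z * cis (\<theta> z))"
  using assms by (intro integrable_cis_mult) (auto simp: measurable_completion)

lemma norm_fourier2_le:
  assumes "integrable lebesgue F"
  shows "cmod (fourier2 F \<xi>) \<le> (LINT z|lebesgue. cmod (F z))"
  unfolding fourier2_def by (rule integral_norm_bound[THEN order_trans]) (simp add: norm_mult)

lemma fourier2_add:
  assumes "integrable lebesgue F" "integrable lebesgue G"
  shows "fourier2 (\<lambda>z. F z + G z) \<xi> = fourier2 F \<xi> + fourier2 G \<xi>"
  unfolding fourier2_def distrib_right
  by (intro Bochner_Integration.integral_add integrable_lebesgue_cis assms) measurable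

lemma noiseless_quotient:
  assumes f: "square_integrable f" and g: "square_integrable g" and nz: "ambiguity g (x, y) \<noteq> 0"
  shows "fourier2 (\<lambda>z. complex_of_real ((cmod (STFT g f z))\<^sup>2)) (y, - x) / cnj (ambiguity g (x, y))
      = ambiguity f (x, y)"
  unfolding fourier2_spectrogram[OF f g] using nz by simp

lemma noisy_quotient:
  assumes f: "square_integrable f" and g: "square_integrable g" and nz: "ambiguity g (x, y) \<noteq> 0"
    and \<eta>: "integrable lebesgue \<eta>"
  shows "fourier2 (\<lambda>z. complex_of_real ((cmod (STFT g f z))\<^sup>2) + \<eta> z) (y, - x) / cnj (ambiguity g (x, y))
      = ambiguity f (x, y) + fourier2 \<eta> (y, - x) / cnj (ambiguity g (x, y))"
  unfolding fourier2_add[OF integrable_spectrogram[OF f g] \<eta>] add_divide_distrib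
    noiseless_quotient[OF f g nz] ..

section \<open>The error estimate\<close>

text \<open>The set \<open>S\<close> need not be measurable, but the support of \<open>D\<close> is a measurable subset of it.\<close>

lemma nn_integral_le_cmult_indicator:
  fixes D :: "'a \<Rightarrow> real"
  assumes [measurable]: "D \<in> borel_measurable M" and "0 \<le> c" and D0: "\<And>y. 0 \<le> D y"
    and D: "\<And>y. D y \<le> c * indicator S y"
  shows "(\<integral>\<^sup>+ y. ennreal (D y) \<partial>M) \<le> ennreal c * (\<integral>\<^sup>+ y. indicator S y \<partial>M)"
proof -
  define T where "T = {y \<in> space M. D y \<noteq> 0}"
  have [measurable]: "T \<in> sets M" unfolding T_def by measurable
  have TS: "T \<subseteq> S"
  proof
    fix y assume "y \<in> T"
    then have "0 < c * indicator S y" using D[of y] D0[of y] by (simp add: T_def)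
    then show "y \<in> S" by (cases "y \<in> S") auto
  qed
  have "(\<integral>\<^sup>+ y. ennreal (D y) \<partial>M) \<le> (\<integral>\<^sup>+ y. ennreal c * indicator T y \<partial>M)"
  proof (rule nn_integral_mono)
    fix y assume "y \<in> space M"
    show "ennreal (D y) \<le> ennreal c * indicator T y"
    proof (cases "D y = 0")
      case False
      then have "y \<in> T" using \<open>y \<in> space M\<close> by (simp add: T_def)
      then have "y \<in> S" using TS by blast
      then show ?thesis using D[of y] \<open>y \<in> T\<close> by (simp add: ennreal_leI)
    qed simp
  qed
  also have "\<dots> = ennreal c * (\<integral>\<^sup>+ y. indicator T y \<partial>M)"
    by (rule nn_integral_cmult) measurable
  also have "\<dots> \<le> ennreal c * (\<integral>\<^sup>+ y. indicator S y \<partial>M)"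
    using TS by (intro mult_left_mono nn_integral_mono) (auto simp: indicator_def)
  finally show ?thesis .
qed

text \<open>The line \<open>x = 0\<close> is a null set, so measurability of \<open>U\<close> in the plane says nothing about this section. A nonzero
phase integral does: its integrand must be integrable.\<close>

lemma measurable_section_of_nonzero_phase_integral:
  assumes "phase_integral U 0 \<noteq> 0"
  shows "(\<lambda>y. U (0, y)) \<in> borel_measurable lebesgue"
proof -
  have "integrable lebesgue (\<lambda>y. U (0, y) * cis (pi * 0 * y))"
    using assms not_integrable_integral_eq unfolding phase_integral_def by blast
  then show ?thesis by (auto dest: borel_measurable_integrable)
qed

text \<open>The first inequality of the theorem, with the windows and the noise reduced to their effect: the data \<open>A\<eta>\<close> deviate
from \<open>A\<close> by at most \<open>c\<close>, and only inside \<open>\<Omega>\<close>.\<close>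

lemma reconstruction_estimate:
  fixes f :: "real \<Rightarrow> complex" and A A\<eta> :: "real \<times> real \<Rightarrow> complex" and p :: real
  defines "u \<equiv> phase_integral (ambiguity f)"
    and "u' \<equiv> phase_integral A" and "u\<eta> \<equiv> phase_integral A\<eta>"
  defines "k \<equiv> sqrt (cmod (u' 0))" and "k\<eta> \<equiv> sqrt (cmod (u\<eta> 0))" and "kt \<equiv> sqrt (Re (u 0))"
  assumes p: "1 \<le> p" and f: "square_integrable f"
    and f0: "f 0 = complex_of_real (cmod (f 0))" "0 < cmod (f 0)"
    and rec: "AE x in lebesgue. u x = f x * cnj (f 0)" and rec0: "u 0 = f 0 * cnj (f 0)"
    and \<Omega>: "\<Omega> \<in> sets lebesgue"
    and A: "\<And>z. A z = indicator \<Omega> z * ambiguity f z"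
    and A\<eta>: "A\<eta> \<in> borel_measurable lebesgue"
    and c: "0 \<le> c" "\<And>z. cmod (A z - A\<eta> z) \<le> c * indicator \<Omega> z"
    and nz: "u' 0 \<noteq> 0" "u\<eta> 0 \<noteq> 0"
  shows "Lp_norm p (\<lambda>x. f x - u\<eta> x / complex_of_real k\<eta>)
    \<le> ennreal (1 / kt) * mixed_norm p (\<lambda>z. indicator (- \<Omega>) z * ambiguity f z)
      + ennreal (1 / (2 * (kt * k) powr (3 / 2)))
        * (\<integral>\<^sup>+ y \<in> {y. (0, y) \<notin> \<Omega>}. ennreal (cmod (ambiguity f (0, y))) \<partial>lebesgue) * mixed_norm p A
      + (ennreal (1 / (2 * (k * k\<eta>) powr (3 / 2))) * mixed_norm p A + ennreal (1 / k\<eta>))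
        * ennreal c * max (axis_measure \<Omega>) (mixed_norm p (indicator \<Omega>))"
proof -
  have p0: "0 < p" using p by simp
  have kt: "kt = cmod (f 0)" "0 < kt"
  proof -
    have "Re (u 0) = (cmod (f 0))\<^sup>2"
      unfolding rec0 by (simp add: complex_norm_square[symmetric] del: of_real_power)
    then show "kt = cmod (f 0)" by (simp add: kt_def)
    then show "0 < kt" using f0 by simp
  qed
  have pos: "0 < k" "0 < k\<eta>" using nz by (auto simp: k_def k\<eta>_def)
  have sq: "kt\<^sup>2 = cmod (u 0)" "k\<^sup>2 = cmod (u' 0)" "k\<eta>\<^sup>2 = cmod (u\<eta> 0)"
    by (auto simp: kt(1) k_def k\<eta>_def rec0 norm_mult power2_eq_square)

  have mAf [measurable]: "ambiguity f \<in> borel_measurable lebesgue"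
    using borel_measurable_ambiguity[OF f] by (simp add: measurable_completion)
  have mA [measurable]: "A \<in> borel_measurable lebesgue"
    using \<Omega> unfolding A by measurable
  have mu [measurable]: "u \<in> borel_measurable lebesgue" "u' \<in> borel_measurable lebesgue" "u\<eta> \<in> borel_measurable lebesgue"
    unfolding u_def u'_def u\<eta>_def by (intro borel_measurable_phase_integral mAf mA A\<eta>)+

  define out where "out = mixed_norm p (\<lambda>z. indicator (- \<Omega>) z * ambiguity f z)"
  define out0 where "out0 = (\<integral>\<^sup>+ y \<in> {y. (0, y) \<notin> \<Omega>}. ennreal (cmod (ambiguity f (0, y))) \<partial>lebesgue)"
  define Cp where "Cp = mixed_norm p (indicator \<Omega> :: real \<times> real \<Rightarrow> complex)"
  define CR where "CR = axis_measure \<Omega>"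

  \<comment> \<open>The squares of the normalising constants are compared along the line \<open>x = 0\<close>.\<close>
  have sec_f: "(\<lambda>y. ambiguity f (0, y)) \<in> borel_measurable lebesgue"
  proof -
    have "(\<lambda>y. ambiguity f (0, y)) \<in> borel_measurable borel"
      by (rule measurable_compose[OF _ borel_measurable_ambiguity[OF f]]) (simp add: borel_prod[symmetric])
    then show ?thesis by (simp add: measurable_completion)
  qed
  have sec_A: "(\<lambda>y. A (0, y)) \<in> borel_measurable lebesgue"
    using nz(1) unfolding u'_def by (rule measurable_section_of_nonzero_phase_integral)
  have sec_A\<eta>: "(\<lambda>y. A\<eta> (0, y)) \<in> borel_measurable lebesgue"
    using nz(2) unfolding u\<eta>_def by (rule measurable_section_of_nonzero_phase_integral)
  have k1: "ennreal \<bar>kt\<^sup>2 - k\<^sup>2\<bar> \<le> out0"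
  proof -
    have "ennreal \<bar>kt\<^sup>2 - k\<^sup>2\<bar> \<le> ennreal (cmod (u 0 - u' 0))"
      unfolding sq by (intro ennreal_leI norm_triangle_ineq3)
    also have "\<dots> \<le> (\<integral>\<^sup>+ y. ennreal (cmod (ambiguity f (0, y) - A (0, y))) \<partial>lebesgue)"
      unfolding u_def u'_def by (rule phase_integral_diff_le[OF sec_f sec_A])
    also have "\<dots> = out0"
      unfolding out0_def by (intro nn_integral_cong) (auto simp: A indicator_def)
    finally show ?thesis .
  qed
  have k2: "ennreal \<bar>k\<^sup>2 - k\<eta>\<^sup>2\<bar> \<le> ennreal c * CR"
  proof -
    have "ennreal \<bar>k\<^sup>2 - k\<eta>\<^sup>2\<bar> \<le> ennreal (cmod (u' 0 - u\<eta> 0))"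
      unfolding sq by (intro ennreal_leI norm_triangle_ineq3)
    also have "\<dots> \<le> (\<integral>\<^sup>+ y. ennreal (cmod (A (0, y) - A\<eta> (0, y))) \<partial>lebesgue)"
      unfolding u'_def u\<eta>_def by (rule phase_integral_diff_le[OF sec_A sec_A\<eta>])
    also have "\<dots> \<le> ennreal c * (\<integral>\<^sup>+ y. indicator {y. (0, y) \<in> \<Omega>} y \<partial>lebesgue)"
    proof (rule nn_integral_le_cmult_indicator)
      show "(\<lambda>y. cmod (A (0, y) - A\<eta> (0, y))) \<in> borel_measurable lebesgue"
        using sec_A sec_A\<eta> by measurable
      show "cmod (A (0, y) - A\<eta> (0, y)) \<le> c * indicator {y. (0, y) \<in> \<Omega>} y" for y
        using c(2)[of "(0, y)"] by (simp add: indicator_def)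
    qed (use c in auto)
    finally show ?thesis by (simp add: CR_def axis_measure_def)
  qed

  have n1: "Lp_norm p (\<lambda>x. u x - u' x) \<le> out"
  proof -
    have "(\<lambda>z. ambiguity f z - A z) = (\<lambda>z. indicator (- \<Omega>) z * ambiguity f z)"
      by (auto simp: A indicator_def)
    then show ?thesis
      using Lp_norm_phase_integral_diff[OF p mAf mA] by (simp add: u_def u'_def out_def)
  qed
  have n2: "Lp_norm p u' \<le> mixed_norm p A"
    unfolding u'_def by (rule Lp_norm_phase_integral[OF p mA])
  have n3: "Lp_norm p (\<lambda>x. u' x - u\<eta> x) \<le> ennreal c * Cp"
  proof -
    have "Lp_norm p (\<lambda>x. u' x - u\<eta> x) \<le> mixed_norm p (\<lambda>z. A z - A\<eta> z)"
      unfolding u'_def u\<eta>_def by (rule Lp_norm_phase_integral_diff[OF p mA A\<eta>])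
    also have "\<dots> \<le> mixed_norm p (\<lambda>z. complex_of_real c * indicator \<Omega> z)"
    proof (rule mixed_norm_mono[OF p0])
      fix z
      show "cmod (A z - A\<eta> z) \<le> cmod (complex_of_real c * indicator \<Omega> z)"
        using c(2)[of z] \<open>0 \<le> c\<close> by (cases "z \<in> \<Omega>") (auto simp: norm_mult)
    qed
    also have "\<dots> = ennreal c * Cp"
      unfolding Cp_def by (intro mixed_norm_cmult p0 c borel_measurable_indicator \<Omega>)
    finally show ?thesis .
  qed

  define a1 a2 a3 a4 where "a1 = 1 / kt" and "a2 = \<bar>1 / kt - 1 / k\<bar>" and "a3 = \<bar>1 / k - 1 / k\<eta>\<bar>" and "a4 = 1 / k\<eta>"
  have a0: "0 \<le> a1" "0 \<le> a2" "0 \<le> a3" "0 \<le> a4" using kt pos by (auto simp: a1_def a2_def a3_def a4_def)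
  define g1 g2 g3 where "g1 x = cmod (u x - u' x)" and "g2 x = cmod (u' x)" and "g3 x = cmod (u' x - u\<eta> x)" for x
  have g0: "0 \<le> g1 x" "0 \<le> g2 x" "0 \<le> g3 x" for x by (auto simp: g1_def g2_def g3_def)
  have [measurable]: "g1 \<in> borel_measurable lebesgue" "g2 \<in> borel_measurable lebesgue" "g3 \<in> borel_measurable lebesgue"
    unfolding g1_def g2_def g3_def by measurable
  have "Lp_norm p (\<lambda>x. f x - u\<eta> x / complex_of_real k\<eta>)
      \<le> pnorm lebesgue p (\<lambda>x. (a1 * g1 x + a2 * g2 x) + (a3 * g2 x + a4 * g3 x))"
    unfolding Lp_norm_eq_pnorm_lebesgue
  proof (rule pnorm_mono_AE[OF p0])
    show "AE x in lebesgue. 0 \<le> cmod (f x - u\<eta> x / complex_of_real k\<eta>)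
        \<and> cmod (f x - u\<eta> x / complex_of_real k\<eta>) \<le> (a1 * g1 x + a2 * g2 x) + (a3 * g2 x + a4 * g3 x)"
      using rec
    proof eventually_elim
      case (elim x)
      have "cnj (f 0) = complex_of_real kt" using f0 kt by (metis complex_cnj_complex_of_real)
      then have fx: "f x = u x / complex_of_real kt" using elim kt by simp
      have "f x - u\<eta> x / complex_of_real k\<eta>
          = (complex_of_real (1 / kt) * (u x - u' x) + complex_of_real (1 / kt - 1 / k) * u' x)
            + (complex_of_real (1 / k - 1 / k\<eta>) * u' x + complex_of_real (1 / k\<eta>) * (u' x - u\<eta> x))"
        unfolding fx by (simp add: algebra_simps)
      also have "cmod \<dots> \<le> (cmod (complex_of_real (1 / kt) * (u x - u' x)) + cmod (complex_of_real (1 / kt - 1 / k) * u' x))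
            + (cmod (complex_of_real (1 / k - 1 / k\<eta>) * u' x) + cmod (complex_of_real (1 / k\<eta>) * (u' x - u\<eta> x)))"
        by (intro norm_triangle_le add_mono norm_triangle_ineq)
      also have "\<dots> = (a1 * g1 x + a2 * g2 x) + (a3 * g2 x + a4 * g3 x)"
        using kt pos unfolding norm_mult norm_of_real by (simp add: a1_def a2_def a3_def a4_def g1_def g2_def g3_def)
      finally show ?case by simp
    qed
  qed
  also have "\<dots> \<le> (pnorm lebesgue p (\<lambda>x. a1 * g1 x) + pnorm lebesgue p (\<lambda>x. a2 * g2 x))
      + (pnorm lebesgue p (\<lambda>x. a3 * g2 x) + pnorm lebesgue p (\<lambda>x. a4 * g3 x))"
    by (intro order_trans[OF pnorm_triangle] add_mono pnorm_triangle sigma_finite_lebesgue p)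
      (auto intro!: add_nonneg_nonneg mult_nonneg_nonneg a0 g0)
  also have "\<dots> = (ennreal a1 * Lp_norm p (\<lambda>x. u x - u' x) + ennreal a2 * Lp_norm p u')
      + (ennreal a3 * Lp_norm p u' + ennreal a4 * Lp_norm p (\<lambda>x. u' x - u\<eta> x))"
    using a0 g0 p0 by (simp add: pnorm_cmult Lp_norm_eq_pnorm_lebesgue g1_def[abs_def] g2_def[abs_def] g3_def[abs_def])
  also have "\<dots> \<le> (ennreal (1 / kt) * out
        + (ennreal (1 / (2 * (kt * k) powr (3 / 2))) * out0) * mixed_norm p A)
      + ((ennreal (1 / (2 * (k * k\<eta>) powr (3 / 2))) * (ennreal c * CR)) * mixed_norm p A
        + ennreal (1 / k\<eta>) * (ennreal c * Cp))"
  proof (intro add_mono mult_mono n1 n2 n3)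
    have "ennreal a2 \<le> ennreal (1 / (2 * (kt * k) powr (3 / 2)) * \<bar>kt\<^sup>2 - k\<^sup>2\<bar>)"
      unfolding a2_def using kt pos by (intro ennreal_leI abs_inverse_diff_le)
    also have "\<dots> = ennreal (1 / (2 * (kt * k) powr (3 / 2))) * ennreal \<bar>kt\<^sup>2 - k\<^sup>2\<bar>"
      by (rule ennreal_mult) auto
    also have "\<dots> \<le> ennreal (1 / (2 * (kt * k) powr (3 / 2))) * out0"
      by (intro mult_left_mono k1) simp
    finally show "ennreal a2 \<le> ennreal (1 / (2 * (kt * k) powr (3 / 2))) * out0" .
    have "ennreal a3 \<le> ennreal (1 / (2 * (k * k\<eta>) powr (3 / 2)) * \<bar>k\<^sup>2 - k\<eta>\<^sup>2\<bar>)"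
      unfolding a3_def using pos by (intro ennreal_leI abs_inverse_diff_le)
    also have "\<dots> = ennreal (1 / (2 * (k * k\<eta>) powr (3 / 2))) * ennreal \<bar>k\<^sup>2 - k\<eta>\<^sup>2\<bar>"
      by (rule ennreal_mult) auto
    also have "\<dots> \<le> ennreal (1 / (2 * (k * k\<eta>) powr (3 / 2))) * (ennreal c * CR)"
      by (intro mult_left_mono k2) simp
    finally show "ennreal a3 \<le> ennreal (1 / (2 * (k * k\<eta>) powr (3 / 2))) * (ennreal c * CR)" .
  qed (auto simp: a1_def a4_def)
  also have "\<dots> \<le> (ennreal (1 / kt) * out
        + (ennreal (1 / (2 * (kt * k) powr (3 / 2))) * out0) * mixed_norm p A)
      + ((ennreal (1 / (2 * (k * k\<eta>) powr (3 / 2))) * (ennreal c * max CR Cp)) * mixed_norm p A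
        + ennreal (1 / k\<eta>) * (ennreal c * max CR Cp))"
    by (intro add_mono mult_mono order_refl) auto
  also have "\<dots> = ennreal (1 / kt) * out
      + ennreal (1 / (2 * (kt * k) powr (3 / 2))) * out0 * mixed_norm p A
      + (ennreal (1 / (2 * (k * k\<eta>) powr (3 / 2))) * mixed_norm p A + ennreal (1 / k\<eta>))
        * ennreal c * max CR Cp"
    by (simp add: distrib_left distrib_right mult_ac)
  finally show ?thesis unfolding out_def out0_def CR_def Cp_def .
qed

lemma mixed_norm_indicator_finite:
  assumes p: "1 \<le> p" and "bounded \<Omega>"
  shows "mixed_norm p (indicator \<Omega> :: real \<times> real \<Rightarrow> complex) < \<infinity>"
proof -
  have p0: "0 < p" using p by simp
  obtain R where R: "0 < R" "\<And>z. z \<in> \<Omega> \<Longrightarrow> norm z \<le> R"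
    using assms(2) by (auto simp: bounded_pos)
  have "mixed_norm p (indicator \<Omega> :: real \<times> real \<Rightarrow> complex) \<le> mixed_norm p (indicator ({- R..R} \<times> {- R..R}))"
  proof (rule mixed_norm_mono[OF p0])
    fix z :: "real \<times> real"
    show "cmod (indicator \<Omega> z) \<le> cmod (indicator ({- R..R} \<times> {- R..R}) z)"
    proof (cases "z \<in> \<Omega>")
      case True
      then have "\<bar>fst z\<bar> \<le> R" "\<bar>snd z\<bar> \<le> R"
        using R(2)[OF True] norm_fst_le[of "fst z" "snd z"] norm_snd_le[of "snd z" "fst z"] by auto
      then show ?thesis by (auto simp: indicator_def mem_Times_iff)
    qed simp
  qed
  also have "\<dots> = (\<integral>\<^sup>+ y. ennreal ((2 * R) powr (1 / p)) * indicator {- R..R} y \<partial>lborel)"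
    unfolding mixed_norm_eq_pnorm
  proof (rule nn_integral_cong)
    fix y :: real
    have "(\<integral>\<^sup>+ x. ennreal (cmod (indicator ({- R..R} \<times> {- R..R}) (x, y)) powr p) \<partial>lborel)
        = (\<integral>\<^sup>+ x. indicator {- R..R} y * indicator {- R..R} x \<partial>lborel)"
      using p0 by (intro nn_integral_cong) (auto simp: indicator_def)
    also have "\<dots> = indicator {- R..R} y * ennreal (2 * R)"
      using R(1) by (subst nn_integral_cmult) auto
    finally show "pnorm lborel p (\<lambda>x. cmod (indicator ({- R..R} \<times> {- R..R}) (x, y)))
        = ennreal ((2 * R) powr (1 / p)) * indicator {- R..R} y"
      using R(1) by (auto simp: pnorm_def indicator_def)
  qed
  also have "\<dots> = ennreal ((2 * R) powr (1 / p)) * ennreal (2 * R)"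
    using R(1) by (subst nn_integral_cmult) auto
  also have "\<dots> < \<infinity>" by (simp add: ennreal_mult_less_top)
  finally show ?thesis .
qed

lemma axis_measure_finite:
  assumes "bounded \<Omega>"
  shows "axis_measure \<Omega> < \<infinity>"
proof -
  obtain R where R: "0 < R" "\<And>z. z \<in> \<Omega> \<Longrightarrow> norm z \<le> R"
    using assms by (auto simp: bounded_pos)
  have "axis_measure \<Omega> \<le> (\<integral>\<^sup>+ y. indicator {- R..R} y \<partial>lborel)"
    unfolding axis_measure_def nn_integral_completion
  proof (rule nn_integral_mono)
    fix y :: real
    show "1 * indicator {y. (0, y) \<in> \<Omega>} y \<le> (indicator {- R..R} y :: ennreal)"
      using R(2)[of "(0, y)"] by (auto simp: indicator_def norm_prod_def)
  qed
  also have "\<dots> < \<infinity>" using R(1) by simp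
  finally show ?thesis .
qed

text \<open>The sum bounds each of the three coefficients in the first estimate. The absolute values and the
summand \<open>1\<close> make it positive for all arguments.\<close>

definition error_constant :: "ennreal \<Rightarrow> real \<Rightarrow> real \<Rightarrow> real \<Rightarrow> ennreal \<Rightarrow> ennreal \<Rightarrow> real" where
  "error_constant a k k\<eta> kt cR cp = 1 + \<bar>1 / kt\<bar> + \<bar>1 / (2 * (kt * k) powr (3 / 2)) * enn2real a\<bar>
    + \<bar>(1 / (2 * (k * k\<eta>) powr (3 / 2)) * enn2real a + 1 / k\<eta>) * enn2real (max cR cp)\<bar>"

lemma error_constant_pos: "0 < error_constant a k k\<eta> kt cR cp"
  unfolding error_constant_def by (intro add_pos_nonneg) auto

lemma error_bound_le_error_constant:
  fixes a cR cp out out0 e :: ennreal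
  assumes "0 \<le> kt" "0 \<le> k\<eta>" and fin: "a < \<infinity>" "cR < \<infinity>" "cp < \<infinity>"
  shows "ennreal (1 / kt) * out + ennreal (1 / (2 * (kt * k) powr (3 / 2))) * out0 * a
      + (ennreal (1 / (2 * (k * k\<eta>) powr (3 / 2))) * a + ennreal (1 / k\<eta>)) * e * max cR cp
    \<le> ennreal (error_constant a k k\<eta> kt cR cp) * (out + out0 + e)"
proof -
  define a' M where "a' = enn2real a" and "M = enn2real (max cR cp)"
  have aM: "a = ennreal a'" "max cR cp = ennreal M" "0 \<le> a'" "0 \<le> M"
    using fin by (auto simp: a'_def M_def max_def)
  define b1 b2 b3 where "b1 = 1 / kt" and "b2 = 1 / (2 * (kt * k) powr (3 / 2)) * a'"
    and "b3 = (1 / (2 * (k * k\<eta>) powr (3 / 2)) * a' + 1 / k\<eta>) * M"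
  have b0: "0 \<le> b1" "0 \<le> b2" "0 \<le> b3"
    using aM(3,4) assms(1,2) by (auto simp: b1_def b2_def b3_def)
  have C: "error_constant a k k\<eta> kt cR cp = 1 + b1 + b2 + b3"
    unfolding error_constant_def a'_def[symmetric] M_def[symmetric]
      b1_def[symmetric] b2_def[symmetric] b3_def[symmetric]
    using b0 by simp
  have b2: "ennreal b2 = ennreal (1 / (2 * (kt * k) powr (3 / 2))) * ennreal a'"
    unfolding b2_def by (rule ennreal_mult) (use aM in auto)
  have b3: "ennreal b3 = (ennreal (1 / (2 * (k * k\<eta>) powr (3 / 2))) * ennreal a' + ennreal (1 / k\<eta>)) * ennreal M"
    unfolding b3_def using aM(3,4) assms(2)
    by (subst ennreal_mult, simp, simp, subst ennreal_plus, simp, simp, subst ennreal_mult, simp_all)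
  have "ennreal (1 / kt) * out + ennreal (1 / (2 * (kt * k) powr (3 / 2))) * out0 * a
      + (ennreal (1 / (2 * (k * k\<eta>) powr (3 / 2))) * a + ennreal (1 / k\<eta>)) * e * max cR cp
      = ennreal b1 * out + ennreal b2 * out0 + ennreal b3 * e"
    unfolding aM(1,2) b2 b3 b1_def by (simp only: mult_ac)
  also have "\<dots> \<le> ennreal (1 + b1 + b2 + b3) * out + ennreal (1 + b1 + b2 + b3) * out0
      + ennreal (1 + b1 + b2 + b3) * e"
    using b0 by (intro add_mono mult_right_mono ennreal_leI) auto
  finally show ?thesis unfolding C by (simp only: distrib_left)
qed

theorem mainTheorem6:
  shows "\<exists>C :: ennreal \<Rightarrow> real \<Rightarrow> real \<Rightarrow> real \<Rightarrow> ennreal \<Rightarrow> ennreal \<Rightarrow> real.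
    (\<forall>a k k\<eta> kt cR cp. 0 < C a k k\<eta> kt cR cp) \<and>
    (\<forall>(p :: real) (N :: nat) (n :: nat \<Rightarrow> nat) (h :: nat \<Rightarrow> real \<Rightarrow> complex)
       (f :: real \<Rightarrow> complex) (\<eta> :: nat \<Rightarrow> real \<times> real \<Rightarrow> complex) (\<epsilon> :: real)
       (\<Omega>j :: nat \<Rightarrow> (real \<times> real) set)
       (A :: real \<times> real \<Rightarrow> complex) (A\<eta> :: real \<times> real \<Rightarrow> complex).
      let u = phase_integral (ambiguity f);
          F = (\<lambda>j z. complex_of_real ((cmod (STFT (h (n j)) f z))\<^sup>2));
          F\<eta> = (\<lambda>j z. complex_of_real ((cmod (STFT (h (n j)) f z))\<^sup>2) + \<eta> j z);
          \<Omega> = (\<Union>j\<in>{1..N}. \<Omega>j j);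
          u' = phase_integral A;
          u\<eta> = phase_integral A\<eta>;
          k = sqrt (cmod (u' 0));
          k\<eta> = sqrt (cmod (u\<eta> 0));
          kt = sqrt (Re (u 0));
          f\<eta> = (\<lambda>x. u\<eta> x / complex_of_real k\<eta>);
          Cp = mixed_norm p (indicator \<Omega>);
          CR = axis_measure \<Omega>;
          out = mixed_norm p (\<lambda>z. indicator (- \<Omega>) z * ambiguity f z);
          out0 = (\<integral>\<^sup>+ y \<in> {y. (0, y) \<notin> \<Omega>}. ennreal (cmod (ambiguity f (0, y))) \<partial>lebesgue);
          noise = Max ((\<lambda>j. Lp_norm 1 (\<eta> j)) ` {1..N})
      in
        1 \<le> p \<longrightarrow> 1 \<le> N \<longrightarrow> strict_mono_on {1..N} n \<longrightarrow>
        (\<forall>j\<in>{1..N}. is_hermite_function (n j) (h (n j))) \<longrightarrow>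
        square_integrable f \<longrightarrow>
        f 0 = complex_of_real (cmod (f 0)) \<longrightarrow> 0 < cmod (f 0) \<longrightarrow>
        (AE x in lebesgue. u x = f x * cnj (f 0)) \<longrightarrow> u 0 = f 0 * cnj (f 0) \<longrightarrow>
        (\<forall>j\<in>{1..N}. integrable lebesgue (\<eta> j)) \<longrightarrow>
        0 < \<epsilon> \<longrightarrow>
        (\<forall>j\<in>{1..N}. \<Omega>j j \<in> sets lebesgue) \<longrightarrow>
        disjoint_family_on \<Omega>j {1..N} \<longrightarrow>
        (\<forall>j\<in>{1..N}. \<forall>z\<in>\<Omega>j j. \<epsilon> < cmod (ambiguity (h (n j)) z)) \<longrightarrow>
        (\<forall>j\<in>{1..N}. \<forall>(x, y)\<in>\<Omega>j j.
            A (x, y) = fourier2 (F j) (y, - x) / cnj (ambiguity (h (n j)) (x, y))) \<longrightarrow>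
        (\<forall>z. z \<notin> \<Omega> \<longrightarrow> A z = 0) \<longrightarrow>
        (\<forall>j\<in>{1..N}. \<forall>(x, y)\<in>\<Omega>j j.
            A\<eta> (x, y) = fourier2 (F\<eta> j) (y, - x) / cnj (ambiguity (h (n j)) (x, y))) \<longrightarrow>
        (\<forall>z. z \<notin> \<Omega> \<longrightarrow> A\<eta> z = 0) \<longrightarrow>
        u' 0 \<noteq> 0 \<longrightarrow> u\<eta> 0 \<noteq> 0 \<longrightarrow>
          Lp_norm p (\<lambda>x. f x - f\<eta> x)
            \<le> ennreal (1 / kt) * out
              + ennreal (1 / (2 * (kt * k) powr (3 / 2))) * out0 * mixed_norm p A
              + (ennreal (1 / (2 * (k * k\<eta>) powr (3 / 2))) * mixed_norm p A + ennreal (1 / k\<eta>))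
                * ennreal (1 / \<epsilon>) * max CR Cp * noise
          \<and>
          Lp_norm p (\<lambda>x. f x - f\<eta> x)
            \<le> ennreal (C (mixed_norm p A) k k\<eta> kt CR Cp) * (out + out0 + ennreal (1 / \<epsilon>) * noise))"
proof (intro exI[of _ error_constant] conjI allI error_constant_pos)
  fix p :: real and N :: nat and n :: "nat \<Rightarrow> nat" and h :: "nat \<Rightarrow> real \<Rightarrow> complex"
    and f :: "real \<Rightarrow> complex" and \<eta> :: "nat \<Rightarrow> real \<times> real \<Rightarrow> complex" and \<epsilon> :: real
    and \<Omega>j :: "nat \<Rightarrow> (real \<times> real) set" and A A\<eta> :: "real \<times> real \<Rightarrow> complex"
  define \<Omega> where "\<Omega> = (\<Union>j\<in>{1..N}. \<Omega>j j)"
  define u u' u\<eta> where "u = phase_integral (ambiguity f)" and "u' = phase_integral A" and "u\<eta> = phase_integral A\<eta>"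
  define k k\<eta> kt where "k = sqrt (cmod (u' 0))" and "k\<eta> = sqrt (cmod (u\<eta> 0))" and "kt = sqrt (Re (u 0))"
  define Cp where "Cp = mixed_norm p (indicator \<Omega> :: real \<times> real \<Rightarrow> complex)"
  define CR where "CR = axis_measure \<Omega>"
  define out where "out = mixed_norm p (\<lambda>z. indicator (- \<Omega>) z * ambiguity f z)"
  define out0 where "out0 = (\<integral>\<^sup>+ y \<in> {y. (0, y) \<notin> \<Omega>}. ennreal (cmod (ambiguity f (0, y))) \<partial>lebesgue)"
  define noise where "noise = Max ((\<lambda>j. Lp_norm 1 (\<eta> j)) ` {1..N})"
  have "Lp_norm p (\<lambda>x. f x - u\<eta> x / complex_of_real k\<eta>)
      \<le> ennreal (1 / kt) * out
        + ennreal (1 / (2 * (kt * k) powr (3 / 2))) * out0 * mixed_norm p A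
        + (ennreal (1 / (2 * (k * k\<eta>) powr (3 / 2))) * mixed_norm p A + ennreal (1 / k\<eta>))
          * ennreal (1 / \<epsilon>) * max CR Cp * noise
    \<and> Lp_norm p (\<lambda>x. f x - u\<eta> x / complex_of_real k\<eta>)
      \<le> ennreal (error_constant (mixed_norm p A) k k\<eta> kt CR Cp) * (out + out0 + ennreal (1 / \<epsilon>) * noise)"
    if p: "1 \<le> p" and N: "1 \<le> N"
      and herm: "\<forall>j\<in>{1..N}. is_hermite_function (n j) (h (n j))"
      and f: "square_integrable f"
      and f0: "f 0 = complex_of_real (cmod (f 0))" "0 < cmod (f 0)"
      and rec: "AE x in lebesgue. u x = f x * cnj (f 0)" and rec0: "u 0 = f 0 * cnj (f 0)"
      and \<eta>: "\<forall>j\<in>{1..N}. integrable lebesgue (\<eta> j)"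
      and \<epsilon>: "0 < \<epsilon>"
      and \<Omega>j: "\<forall>j\<in>{1..N}. \<Omega>j j \<in> sets lebesgue"
      and disj: "disjoint_family_on \<Omega>j {1..N}"
      and big: "\<forall>j\<in>{1..N}. \<forall>z\<in>\<Omega>j j. \<epsilon> < cmod (ambiguity (h (n j)) z)"
      and A: "\<forall>j\<in>{1..N}. \<forall>(x, y)\<in>\<Omega>j j. A (x, y)
          = fourier2 (\<lambda>z. complex_of_real ((cmod (STFT (h (n j)) f z))\<^sup>2)) (y, - x) / cnj (ambiguity (h (n j)) (x, y))"
      and A0: "\<forall>z. z \<notin> \<Omega> \<longrightarrow> A z = 0"
      and A\<eta>: "\<forall>j\<in>{1..N}. \<forall>(x, y)\<in>\<Omega>j j. A\<eta> (x, y)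
          = fourier2 (\<lambda>z. complex_of_real ((cmod (STFT (h (n j)) f z))\<^sup>2) + \<eta> j z) (y, - x) / cnj (ambiguity (h (n j)) (x, y))"
      and A\<eta>0: "\<forall>z. z \<notin> \<Omega> \<longrightarrow> A\<eta> z = 0"
      and nz: "u' 0 \<noteq> 0" "u\<eta> 0 \<noteq> 0"
  proof -
    have h: "square_integrable (h (n j))" if "j \<in> {1..N}" for j
      using herm that square_integrable_hermite by blast
    have \<Omega>m: "\<Omega> \<in> sets lebesgue" unfolding \<Omega>_def using \<Omega>j by (intro sets.finite_UN) auto
    have \<Omega>b: "bounded \<Omega>"
      unfolding \<Omega>_def
    proof (intro bounded_UN ballI)
      fix j assume j: "j \<in> {1..N}"
      show "bounded (\<Omega>j j)"
        using big j by (intro bounded_subset[OF ambiguity_superlevel_bounded[OF h[OF j] \<epsilon>]]) auto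
    qed simp
    have Af: "A z = indicator \<Omega> z * ambiguity f z" for z
    proof (cases "z \<in> \<Omega>")
      case True
      then obtain j where j: "j \<in> {1..N}" "z \<in> \<Omega>j j" by (auto simp: \<Omega>_def)
      obtain x y where z: "z = (x, y)" by force
      have nz: "ambiguity (h (n j)) (x, y) \<noteq> 0" using big \<epsilon> j unfolding z by fastforce
      have "A (x, y) = ambiguity f (x, y)"
        using A j noiseless_quotient[OF f h[OF j(1)] nz] unfolding z by fastforce
      then show ?thesis using True by (simp add: z)
    next
      case False
      then show ?thesis using A0 by (cases z) auto
    qed
    define nr where "nr j = (LINT z|lebesgue. cmod (\<eta> j z))" for j
    define m where "m = Max (nr ` {1..N})"
    have nr: "Lp_norm 1 (\<eta> j) = ennreal (nr j)" "0 \<le> nr j" if "j \<in> {1..N}" for j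
      using \<eta> that by (auto simp: Lp_norm_1_eq_integral nr_def integral_nonneg_AE)
    have m: "nr j \<le> m" if "j \<in> {1..N}" for j
      unfolding m_def using that by (intro Max_ge) auto
    have m0: "0 \<le> m" using nr(2)[of 1] m[of 1] N by auto
    have noise: "noise = ennreal m"
    proof -
      have "(\<lambda>j. Lp_norm 1 (\<eta> j)) ` {1..N} = ennreal ` (nr ` {1..N})"
        using nr(1) by (auto simp: image_image)
      then show ?thesis
        unfolding noise_def m_def using N
        by (simp only:) (subst mono_Max_commute[of ennreal], auto intro: monoI ennreal_leI)
    qed
    have diff: "A\<eta> z = A z + (\<Sum>j\<in>{1..N}. indicator (\<Omega>j j) z * (fourier2 (\<eta> j) (snd z, - fst z) / cnj (ambiguity (h (n j)) z)))"
      and diff_le: "cmod (A z - A\<eta> z) \<le> m / \<epsilon> * indicator \<Omega> z" for z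
    proof -
      define s where "s j = fourier2 (\<eta> j) (snd z, - fst z) / cnj (ambiguity (h (n j)) z)" for j
      have "A\<eta> z = A z + (\<Sum>j\<in>{1..N}. indicator (\<Omega>j j) z * s j) \<and> cmod (A z - A\<eta> z) \<le> m / \<epsilon> * indicator \<Omega> z"
      proof (cases "z \<in> \<Omega>")
        case True
        then obtain j where j: "j \<in> {1..N}" "z \<in> \<Omega>j j" by (auto simp: \<Omega>_def)
        obtain x y where z: "z = (x, y)" by force
        have nz: "ambiguity (h (n j)) (x, y) \<noteq> 0" using big \<epsilon> j unfolding z by fastforce
        have "A\<eta> (x, y) = ambiguity f (x, y) + s j"
          using A\<eta> j \<eta> noisy_quotient[OF f h[OF j(1)] nz, of "\<eta> j"] unfolding z s_def by fastforce
        then have eq: "A\<eta> z = A z + s j" using True by (simp add: Af z)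
        have "indicator (\<Omega>j i) z * s i = 0" if "i \<in> {1..N} - {j}" for i
        proof -
          have "\<Omega>j i \<inter> \<Omega>j j = {}" using disj j(1) that unfolding disjoint_family_on_def by blast
          then have "z \<notin> \<Omega>j i" using j(2) by blast
          then show ?thesis by simp
        qed
        then have "(\<Sum>i\<in>{1..N} - {j}. indicator (\<Omega>j i) z * s i) = 0"
          by (intro sum.neutral ballI)
        then have "(\<Sum>i\<in>{1..N}. indicator (\<Omega>j i) z * s i) = indicator (\<Omega>j j) z * s j"
          using j(1) by (simp only: sum.remove[OF finite_atLeastAtMost j(1)] add_0_right)
        then have sum: "(\<Sum>i\<in>{1..N}. indicator (\<Omega>j i) z * s i) = s j" using j by simp
        have "cmod (s j) = cmod (fourier2 (\<eta> j) (snd z, - fst z)) / cmod (ambiguity (h (n j)) z)"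
          by (simp add: s_def norm_divide)
        also have "\<dots> \<le> m / \<epsilon>"
        proof (rule frac_le)
          show "cmod (fourier2 (\<eta> j) (snd z, - fst z)) \<le> m"
            using norm_fourier2_le[of "\<eta> j"] \<eta> m[OF j(1)] j(1) unfolding nr_def by (meson order_trans)
          show "\<epsilon> \<le> cmod (ambiguity (h (n j)) z)" using big j by (meson less_imp_le)
        qed (use m0 \<epsilon> in auto)
        finally show ?thesis using eq sum True by simp
      next
        case False
        then have "indicator (\<Omega>j j) z * s j = 0" if "j \<in> {1..N}" for j
          using that by (auto simp: \<Omega>_def)
        then have "(\<Sum>j\<in>{1..N}. indicator (\<Omega>j j) z * s j) = 0"
          by (intro sum.neutral ballI)
        moreover have "A z = 0" "A\<eta> z = 0" using False A0 A\<eta>0 by blast+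
        ultimately show ?thesis using False by simp
      qed
      then show "A\<eta> z = A z + (\<Sum>j\<in>{1..N}. indicator (\<Omega>j j) z * (fourier2 (\<eta> j) (snd z, - fst z) / cnj (ambiguity (h (n j)) z)))"
        "cmod (A z - A\<eta> z) \<le> m / \<epsilon> * indicator \<Omega> z"
        unfolding s_def by blast+
    qed
    have meas_amb: "ambiguity g \<in> borel_measurable lebesgue" if "square_integrable g" for g
      using borel_measurable_ambiguity[OF that] by (simp add: measurable_completion)
    have A\<eta>m: "A\<eta> \<in> borel_measurable lebesgue"
    proof -
      have "(\<lambda>z. fourier2 (\<eta> j) (snd z, - fst z)) \<in> borel_measurable lebesgue" if "j \<in> {1..N}" for j
      proof -
        have "(\<lambda>z :: real \<times> real. (snd z, - fst z)) \<in> borel_measurable borel"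
          by (intro borel_measurable_continuous_onI continuous_intros)
        then have "(\<lambda>z. fourier2 (\<eta> j) (snd z, - fst z)) \<in> borel_measurable borel"
          using \<eta> that by (intro measurable_compose[OF _ borel_measurable_fourier2]) auto
        then show ?thesis by (simp add: measurable_completion)
      qed
      then have "(\<lambda>z. indicator \<Omega> z * ambiguity f z + (\<Sum>j\<in>{1..N}. indicator (\<Omega>j j) z
          * (fourier2 (\<eta> j) (snd z, - fst z) / cnj (ambiguity (h (n j)) z)))) \<in> borel_measurable lebesgue"
        using \<Omega>j \<Omega>m
        by (intro borel_measurable_add borel_measurable_sum borel_measurable_times borel_measurable_divide
            borel_measurable_indicator meas_amb f measurable_compose[OF _ borel_measurable_cnj] h) auto
      then show ?thesis unfolding diff Af .
    qed
    have m\<epsilon>: "ennreal (m / \<epsilon>) = ennreal (1 / \<epsilon>) * noise"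
      unfolding noise using m0 \<epsilon> by (simp add: ennreal_mult[symmetric])
    have est: "Lp_norm p (\<lambda>x. f x - u\<eta> x / complex_of_real k\<eta>)
      \<le> ennreal (1 / kt) * out
        + ennreal (1 / (2 * (kt * k) powr (3 / 2))) * out0 * mixed_norm p A
        + (ennreal (1 / (2 * (k * k\<eta>) powr (3 / 2))) * mixed_norm p A + ennreal (1 / k\<eta>))
          * ennreal (m / \<epsilon>) * max CR Cp"
      unfolding out_def out0_def CR_def Cp_def kt_def k_def k\<eta>_def u_def u'_def u\<eta>_def
      by (rule reconstruction_estimate)
        (use p f f0 rec rec0 \<Omega>m Af A\<eta>m m0 \<epsilon> diff_le nz in \<open>auto simp: u_def u'_def u\<eta>_def\<close>)
    have Cp_fin: "Cp < \<infinity>" unfolding Cp_def by (rule mixed_norm_indicator_finite[OF p \<Omega>b])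
    have CR_fin: "CR < \<infinity>" unfolding CR_def by (rule axis_measure_finite[OF \<Omega>b])
    have A_fin: "mixed_norm p A < \<infinity>"
    proof -
      obtain B where B: "0 \<le> B" "\<And>z. cmod (ambiguity f z) \<le> B"
        using ambiguity_bounded[OF f] by metis
      have "mixed_norm p A \<le> mixed_norm p (\<lambda>z. complex_of_real B * indicator \<Omega> z)"
      proof (rule mixed_norm_mono)
        show "cmod (A z) \<le> cmod (complex_of_real B * indicator \<Omega> z)" for z
          using B unfolding Af by (cases "z \<in> \<Omega>") (auto simp: norm_mult)
      qed (use p in simp)
      also have "\<dots> = ennreal B * Cp"
        unfolding Cp_def using \<Omega>m p B by (intro mixed_norm_cmult) auto
      also have "\<dots> < \<infinity>" using Cp_fin by (simp add: ennreal_mult_less_top)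
      finally show ?thesis .
    qed
    have "0 \<le> kt" "0 \<le> k\<eta>" by (auto simp: kt_def k\<eta>_def rec0)
    from error_bound_le_error_constant[OF this A_fin CR_fin Cp_fin]
    have "Lp_norm p (\<lambda>x. f x - u\<eta> x / complex_of_real k\<eta>)
        \<le> ennreal (error_constant (mixed_norm p A) k k\<eta> kt CR Cp) * (out + out0 + ennreal (m / \<epsilon>))"
      using est by (rule order_trans[rotated])
    then show ?thesis using est unfolding m\<epsilon> by (simp only: mult_ac)
  qed
  then show "let u = phase_integral (ambiguity f);
        F = (\<lambda>j z. complex_of_real ((cmod (STFT (h (n j)) f z))\<^sup>2));
        F\<eta> = (\<lambda>j z. complex_of_real ((cmod (STFT (h (n j)) f z))\<^sup>2) + \<eta> j z);
        \<Omega> = (\<Union>j\<in>{1..N}. \<Omega>j j);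
        u' = phase_integral A;
        u\<eta> = phase_integral A\<eta>;
        k = sqrt (cmod (u' 0));
        k\<eta> = sqrt (cmod (u\<eta> 0));
        kt = sqrt (Re (u 0));
        f\<eta> = (\<lambda>x. u\<eta> x / complex_of_real k\<eta>);
        Cp = mixed_norm p (indicator \<Omega>);
        CR = axis_measure \<Omega>;
        out = mixed_norm p (\<lambda>z. indicator (- \<Omega>) z * ambiguity f z);
        out0 = (\<integral>\<^sup>+ y \<in> {y. (0, y) \<notin> \<Omega>}. ennreal (cmod (ambiguity f (0, y))) \<partial>lebesgue);
        noise = Max ((\<lambda>j. Lp_norm 1 (\<eta> j)) ` {1..N})
    in
      1 \<le> p \<longrightarrow> 1 \<le> N \<longrightarrow> strict_mono_on {1..N} n \<longrightarrow>
      (\<forall>j\<in>{1..N}. is_hermite_function (n j) (h (n j))) \<longrightarrow>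
      square_integrable f \<longrightarrow>
      f 0 = complex_of_real (cmod (f 0)) \<longrightarrow> 0 < cmod (f 0) \<longrightarrow>
      (AE x in lebesgue. u x = f x * cnj (f 0)) \<longrightarrow> u 0 = f 0 * cnj (f 0) \<longrightarrow>
      (\<forall>j\<in>{1..N}. integrable lebesgue (\<eta> j)) \<longrightarrow>
      0 < \<epsilon> \<longrightarrow>
      (\<forall>j\<in>{1..N}. \<Omega>j j \<in> sets lebesgue) \<longrightarrow>
      disjoint_family_on \<Omega>j {1..N} \<longrightarrow>
      (\<forall>j\<in>{1..N}. \<forall>z\<in>\<Omega>j j. \<epsilon> < cmod (ambiguity (h (n j)) z)) \<longrightarrow>
      (\<forall>j\<in>{1..N}. \<forall>(x, y)\<in>\<Omega>j j.
          A (x, y) = fourier2 (F j) (y, - x) / cnj (ambiguity (h (n j)) (x, y))) \<longrightarrow>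
      (\<forall>z. z \<notin> \<Omega> \<longrightarrow> A z = 0) \<longrightarrow>
      (\<forall>j\<in>{1..N}. \<forall>(x, y)\<in>\<Omega>j j.
          A\<eta> (x, y) = fourier2 (F\<eta> j) (y, - x) / cnj (ambiguity (h (n j)) (x, y))) \<longrightarrow>
      (\<forall>z. z \<notin> \<Omega> \<longrightarrow> A\<eta> z = 0) \<longrightarrow>
      u' 0 \<noteq> 0 \<longrightarrow> u\<eta> 0 \<noteq> 0 \<longrightarrow>
        Lp_norm p (\<lambda>x. f x - f\<eta> x)
          \<le> ennreal (1 / kt) * out
            + ennreal (1 / (2 * (kt * k) powr (3 / 2))) * out0 * mixed_norm p A
            + (ennreal (1 / (2 * (k * k\<eta>) powr (3 / 2))) * mixed_norm p A + ennreal (1 / k\<eta>))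
              * ennreal (1 / \<epsilon>) * max CR Cp * noise
        \<and>
        Lp_norm p (\<lambda>x. f x - f\<eta> x)
          \<le> ennreal (error_constant (mixed_norm p A) k k\<eta> kt CR Cp) * (out + out0 + ennreal (1 / \<epsilon>) * noise)"
    unfolding Let_def \<Omega>_def u_def u'_def u\<eta>_def k_def k\<eta>_def kt_def Cp_def CR_def out_def out0_def noise_def
    by blast
qed

end
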